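(* Let $R$ be a finite commutative ring with unity given as a ring oracle, whose elements are encoded using binary strings of length $m$. Let $f\in R\{x_1,\ldots,x_n\}$ be a polynomial of degree $d$ given by a noncommutative arithmetic circuit $C$. Then there is a randomized polynomial-time algorithm, with running time $\mathrm{poly}(n,d,m)$, that tests whether $f\equiv 0$ in $R\{x_1,\ldots,x_n\}$.
   Context: $R\{x_1,\ldots,x_n\}$ is the ring of polynomials in noncommuting variables over $R$. A ring oracle: elements of $R$ are encoded as strings in $\{0,1\}^m$, with designated strings for $0$ and $1$, and ring operations are performed by oracle queries. A noncommutative arithmetic circuit takes as inputs the variables and ring elements and has addition gates and order-respecting multiplication gates.
   Formalization: The running time proved is polynomial in n, d, m and the size of the circuit C; a bound in n, d, m alone is false, since a sum of arbitrarily many ring constants (n = d = 0) must be read in full. *)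

theory Defs
  imports "HOL-Algebra.Ring" "HOL-Probability.Probability_Mass_Function"
begin

(* Rings presented by strings: an element is identified with its encoding, so the carrier is a set
   of bit strings of length m; in particular the ring is finite and its zero and one are the
   designated strings.  HOL-Algebra leaves the operations of R unconstrained outside the carrier,
   so an oracle computing them answers queries on other strings arbitrarily. *)

type_synonym bits = "bool list"

definition string_ring :: "nat \<Rightarrow> bits ring \<Rightarrow> bool" where
  "string_ring m R \<longleftrightarrow> cring R \<and> carrier R \<subseteq> {xs. length xs = m}"


(* The ring R{x_0, ..., x_(n-1)}: a polynomial is the function giving the coefficient of each
   word; the product is the convolution over all ways to cut a word in two. *)

definition free_algebra ::
  "('a, 'b) ring_scheme \<Rightarrow> nat \<Rightarrow> (nat list \<Rightarrow> 'a) ring" where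
  "free_algebra R n =
    \<lparr> carrier = {f. (\<forall>w. f w \<in> carrier R) \<and> finite {w. f w \<noteq> \<zero>\<^bsub>R\<^esub>} \<and>
                    (\<forall>w. f w \<noteq> \<zero>\<^bsub>R\<^esub> \<longrightarrow> set w \<subseteq> {..<n})},
      monoid.mult = (\<lambda>f g w. \<Oplus>\<^bsub>R\<^esub> i\<in>{..length w}. f (take i w) \<otimes>\<^bsub>R\<^esub> g (drop i w)),
      monoid.one = (\<lambda>w. if w = [] then \<one>\<^bsub>R\<^esub> else \<zero>\<^bsub>R\<^esub>),
      ring.zero = (\<lambda>w. \<zero>\<^bsub>R\<^esub>),
      ring.add = (\<lambda>f g w. f w \<oplus>\<^bsub>R\<^esub> g w) \<rparr>"

definition nc_var :: "('a, 'b) ring_scheme \<Rightarrow> nat \<Rightarrow> nat list \<Rightarrow> 'a" where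
  "nc_var R i = (\<lambda>w. if w = [i] then \<one>\<^bsub>R\<^esub> else \<zero>\<^bsub>R\<^esub>)"

definition nc_const :: "('a, 'b) ring_scheme \<Rightarrow> 'a \<Rightarrow> nat list \<Rightarrow> 'a" where
  "nc_const R a = (\<lambda>w. if w = [] then a else \<zero>\<^bsub>R\<^esub>)"

(* The zero polynomial has degree 0. *)
definition nc_degree :: "('a, 'b) ring_scheme \<Rightarrow> (nat list \<Rightarrow> 'a) \<Rightarrow> nat" where
  "nc_degree R f = Max (insert 0 (length ` {w. f w \<noteq> \<zero>\<^bsub>R\<^esub>}))"


(* A circuit lists its gates in topological order.  The operands of an arithmetic gate are
   positions of earlier gates (fan-out is unrestricted), and the last gate is the output. *)

datatype 'a gate =
    VarGate nat
  | ConstGate 'a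
  | AddGate nat nat
  | MulGate nat nat

type_synonym 'a circuit = "'a gate list"

primrec wf_gate :: "('a, 'b) ring_scheme \<Rightarrow> nat \<Rightarrow> nat \<Rightarrow> 'a gate \<Rightarrow> bool" where
  "wf_gate R n p (VarGate i) \<longleftrightarrow> i < n"
| "wf_gate R n p (ConstGate a) \<longleftrightarrow> a \<in> carrier R"
| "wf_gate R n p (AddGate j k) \<longleftrightarrow> j < p \<and> k < p"
| "wf_gate R n p (MulGate j k) \<longleftrightarrow> j < p \<and> k < p"

definition wf_circuit :: "('a, 'b) ring_scheme \<Rightarrow> nat \<Rightarrow> 'a circuit \<Rightarrow> bool" where
  "wf_circuit R n C \<longleftrightarrow> C \<noteq> [] \<and> (\<forall>p<length C. wf_gate R n p (C ! p))"

primrec gate_poly ::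
  "('a, 'b) ring_scheme \<Rightarrow> nat \<Rightarrow> (nat list \<Rightarrow> 'a) list \<Rightarrow> 'a gate \<Rightarrow> nat list \<Rightarrow> 'a" where
  "gate_poly R n fs (VarGate i) = nc_var R i"
| "gate_poly R n fs (ConstGate a) = nc_const R a"
| "gate_poly R n fs (AddGate j k) = fs ! j \<oplus>\<^bsub>free_algebra R n\<^esub> fs ! k"
| "gate_poly R n fs (MulGate j k) = fs ! j \<otimes>\<^bsub>free_algebra R n\<^esub> fs ! k"

definition circuit_poly :: "('a, 'b) ring_scheme \<Rightarrow> nat \<Rightarrow> 'a circuit \<Rightarrow> nat list \<Rightarrow> 'a" where
  "circuit_poly R n C = last (foldl (\<lambda>fs g. fs @ [gate_poly R n fs g]) [] C)"


(* Probabilistic random access machines with a ring oracle.  A machine has registers and a memory,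
   both holding natural numbers, and is programmed by structured commands.  Time is the number of
   steps.  Addition and subtraction are the only arithmetic and the oracle maps ring elements to
   numbers of m bits, so a step lengthens the largest number by at most one bit (or up to m bits),
   and unit cost is polynomially related to time on a Turing machine.

   A string of length m is held as the number whose binary digits it lists, least significant
   first; of a number used as an oracle query, only the m low digits are read. *)

datatype com =
    Skip
  | SetConst nat nat             \<comment> \<open>\<open>r x := k\<close>\<close>
  | AddReg nat nat nat           \<comment> \<open>\<open>r x := r y + r z\<close>\<close>
  | SubReg nat nat nat           \<comment> \<open>\<open>r x := r y - r z\<close>, truncated at 0\<close>
  | Load nat nat                 \<comment> \<open>\<open>r x := h (r y)\<close>\<close>
  | Store nat nat                \<comment> \<open>\<open>h (r x) := r y\<close>\<close>
  | Coin nat                     \<comment> \<open>\<open>r x :=\<close> a fair random bit\<close>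
  | RingAdd nat nat nat
  | RingNeg nat nat
  | RingMul nat nat nat
  | Seq com com
  | IfLess nat nat com com
  | WhileLess nat nat com

definition encode_bits :: "bits \<Rightarrow> nat" where
  "encode_bits xs = horner_sum of_bool 2 xs"

definition decode_bits :: "nat \<Rightarrow> nat \<Rightarrow> bits" where
  "decode_bits m a = map (bit a) [0..<m]"

(* remaining command, registers, memory *)
type_synonym config = "com \<times> (nat \<Rightarrow> nat) \<times> (nat \<Rightarrow> nat)"

fun step :: "nat \<Rightarrow> bits ring \<Rightarrow> config \<Rightarrow> config pmf" where
  "step m R (Skip, r, h) = return_pmf (Skip, r, h)"
| "step m R (SetConst x k, r, h) = return_pmf (Skip, r(x := k), h)"
| "step m R (AddReg x y z, r, h) = return_pmf (Skip, r(x := r y + r z), h)"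
| "step m R (SubReg x y z, r, h) = return_pmf (Skip, r(x := r y - r z), h)"
| "step m R (Load x y, r, h) = return_pmf (Skip, r(x := h (r y)), h)"
| "step m R (Store x y, r, h) = return_pmf (Skip, r, h(r x := r y))"
| "step m R (Coin x, r, h) =
     map_pmf (\<lambda>b. (Skip, r(x := of_bool b), h)) (bernoulli_pmf (1 / 2))"
| "step m R (RingAdd x y z, r, h) =
     return_pmf (Skip, r(x := encode_bits (decode_bits m (r y) \<oplus>\<^bsub>R\<^esub> decode_bits m (r z))), h)"
| "step m R (RingNeg x y, r, h) =
     return_pmf (Skip, r(x := encode_bits (\<ominus>\<^bsub>R\<^esub> decode_bits m (r y))), h)"
| "step m R (RingMul x y z, r, h) =
     return_pmf (Skip, r(x := encode_bits (decode_bits m (r y) \<otimes>\<^bsub>R\<^esub> decode_bits m (r z))), h)"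
| "step m R (Seq c1 c2, r, h) =
     (if c1 = Skip then return_pmf (c2, r, h)
      else map_pmf (\<lambda>(c, s). (Seq c c2, s)) (step m R (c1, r, h)))"
| "step m R (IfLess x y c1 c2, r, h) = return_pmf (if r x < r y then c1 else c2, r, h)"
| "step m R (WhileLess x y c, r, h) =
     return_pmf (if r x < r y then Seq c (WhileLess x y c) else Skip, r, h)"

primrec run :: "nat \<Rightarrow> bits ring \<Rightarrow> nat \<Rightarrow> config \<Rightarrow> config pmf" where
  "run m R 0 cf = return_pmf cf"
| "run m R (Suc t) cf = bind_pmf (step m R cf) (run m R t)"

definition halted :: "config \<Rightarrow> bool" where
  "halted cf \<longleftrightarrow> fst cf = Skip"

definition accepting :: "config \<Rightarrow> bool" where
  "accepting cf \<longleftrightarrow> halted cf \<and> fst (snd cf) 0 = 1"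

primrec gate_input :: "bits gate \<Rightarrow> nat list" where
  "gate_input (VarGate i) = [0, i, 0]"
| "gate_input (ConstGate a) = [1, encode_bits a, 0]"
| "gate_input (AddGate j k) = [2, j, k]"
| "gate_input (MulGate j k) = [3, j, k]"

definition pit_input :: "nat \<Rightarrow> bits ring \<Rightarrow> nat \<Rightarrow> nat \<Rightarrow> bits circuit \<Rightarrow> nat list" where
  "pit_input m R n d C =
     [n, d, m, encode_bits \<zero>\<^bsub>R\<^esub>, encode_bits \<one>\<^bsub>R\<^esub>, length C] @ concat (map gate_input C)"

(* Initially all registers are 0, and the input fills the memory from address 0, followed by 0s. *)
definition start :: "com \<Rightarrow> nat list \<Rightarrow> config" where
  "start P input = (P, (\<lambda>_. 0), (\<lambda>a. if a < length input then input ! a else 0))"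

end

theory Submission
  imports Defs
begin

text \<open>Send each variable to the transition matrix of its letter in a random automaton with \<open>d + 1\<close> layers
  of \<open>K = 2\<^sup>l \<ge> 3 * d\<close> states, whose transitions go from each layer to independent uniform states of the next.
  Entry \<open>(p, q)\<close> of the value of \<open>f\<close> is the sum of the coefficients of the words leading from \<open>p\<close> to \<open>q\<close>; words
  longer than \<open>d\<close> contribute nothing, so high-degree intermediate results of the circuit do no harm.  If \<open>f\<close> has
  a nonzero coefficient at \<open>w\<close>, then after reading \<open>t\<close> letters some state of layer \<open>t\<close> should still carry a
  nonzero coefficient at the rest of \<open>w\<close>.  A layer destroys this with probability at most \<open>1 / K\<close>: fixing all
  transitions but one that moves a nonzero coefficient, at most one choice of its target cancels everything.
  So the first row of the value vanishes with probability at most \<open>d / K \<le> 1 / 3\<close>, for any ring.  All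
  matrices have entries in \<open>R\<close> and polynomial size.\<close>

section \<open>Execution with given coin flips\<close>

text \<open>Substituting random ring elements and counting roots fails: R may have zero divisors and
  very few elements, so a nonzero polynomial can vanish at every point. The matrices of the letters
  therefore contain only zeros and ones, and the randomness lies in where the ones stand. An entry
  of the value is then a plain sum of coefficients of f, and the error estimate needs only the
  additive group of R. Layers are there to keep the choices independent: the t-th letter always
  consults a fresh part of the table, so no transition is used at two positions of a word. The size
  \<open>K\<close> is a power of two so that \<open>l\<close> fair coins yield an exactly uniform
  state without rejection. Acceptance means that the row vanishes, so the zero polynomial is always
  accepted and the error is one-sided. The machine interleaves coins with computation. To separate
  the two, all coins are drawn in advance as one list. The run is then a function of that list,
  correctness is proved for every list, and probability enters only through the distribution of the
  table that the list spells out.\<close>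

fun dstep :: "nat \<Rightarrow> bits ring \<Rightarrow> config \<times> bits \<Rightarrow> config \<times> bits" where
  "dstep m R ((Coin x, r, h), bs) =
     (case bs of [] \<Rightarrow> ((Coin x, r, h), []) | b # bs' \<Rightarrow> ((Skip, r(x := of_bool b), h), bs'))"
| "dstep m R ((Seq c1 c2, r, h), bs) =
     (if c1 = Skip then ((c2, r, h), bs)
      else case dstep m R ((c1, r, h), bs) of ((c, s), bs') \<Rightarrow> ((Seq c c2, s), bs'))"
| "dstep m R ((Skip, r, h), bs) = ((Skip, r, h), bs)"
| "dstep m R ((SetConst x k, r, h), bs) = ((Skip, r(x := k), h), bs)"
| "dstep m R ((AddReg x y z, r, h), bs) = ((Skip, r(x := r y + r z), h), bs)"
| "dstep m R ((SubReg x y z, r, h), bs) = ((Skip, r(x := r y - r z), h), bs)"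
| "dstep m R ((Load x y, r, h), bs) = ((Skip, r(x := h (r y)), h), bs)"
| "dstep m R ((Store x y, r, h), bs) = ((Skip, r, h(r x := r y)), bs)"
| "dstep m R ((RingAdd x y z, r, h), bs) =
     ((Skip, r(x := encode_bits (decode_bits m (r y) \<oplus>\<^bsub>R\<^esub> decode_bits m (r z))), h), bs)"
| "dstep m R ((RingNeg x y, r, h), bs) =
     ((Skip, r(x := encode_bits (\<ominus>\<^bsub>R\<^esub> decode_bits m (r y))), h), bs)"
| "dstep m R ((RingMul x y z, r, h), bs) =
     ((Skip, r(x := encode_bits (decode_bits m (r y) \<otimes>\<^bsub>R\<^esub> decode_bits m (r z))), h), bs)"
| "dstep m R ((IfLess x y c1 c2, r, h), bs) = ((if r x < r y then c1 else c2, r, h), bs)"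
| "dstep m R ((WhileLess x y c, r, h), bs) =
     ((if r x < r y then Seq c (WhileLess x y c) else Skip, r, h), bs)"

definition drun :: "nat \<Rightarrow> bits ring \<Rightarrow> nat \<Rightarrow> config \<times> bits \<Rightarrow> config \<times> bits" where
  "drun m R t = dstep m R ^^ t"

text \<open>Only \<open>Seq\<close> needs the induction: it inherits whichever alternative holds for
  its first command. Nothing is claimed about a coin toss on the empty list, where
  \<open>dstep\<close> is stuck.\<close>

lemma step_cases:
  "(\<exists>cf. step m R (c, r, h) = return_pmf cf \<and> (\<forall>bs. dstep m R ((c, r, h), bs) = (cf, bs))) \<or>
   (\<exists>F. step m R (c, r, h) = map_pmf F (bernoulli_pmf (1/2)) \<and>
      (\<forall>b bs. dstep m R ((c, r, h), b # bs) = (F b, bs)))"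
proof (induction c)
  case (Coin x)
  show ?case by (rule disjI2, rule exI[of _ "\<lambda>b. (Skip, r(x := of_bool b), h)"]) simp
next
  case (Seq c1 c2)
  show ?case
  proof (cases "c1 = Skip")
    case False
    from Seq.IH(1) show ?thesis
    proof (elim disjE exE conjE)
      fix cf assume *: "step m R (c1, r, h) = return_pmf cf"
        "\<forall>bs. dstep m R ((c1, r, h), bs) = (cf, bs)"
      show ?thesis
        by (rule disjI1, rule exI[of _ "(\<lambda>(c, s). (Seq c c2, s)) cf"])
          (use False * in \<open>auto simp: map_return_pmf split: prod.splits\<close>)
    next
      fix F assume *: "step m R (c1, r, h) = map_pmf F (bernoulli_pmf (1/2))"
        "\<forall>b bs. dstep m R ((c1, r, h), b # bs) = (F b, bs)"
      show ?thesis
        by (rule disjI2, rule exI[of _ "(\<lambda>(c, s). (Seq c c2, s)) \<circ> F"])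
          (use False * in \<open>auto simp: pmf.map_comp comp_def split: prod.splits\<close>)
    qed
  qed auto
qed auto

text \<open>A step reads at most one coin, so \<open>T\<close> coins are enough and the unread ones
  integrate away. The length \<open>M\<close> is separate from \<open>T\<close> because a
  deterministic step lowers the remaining time but leaves the list as it is.\<close>

lemma run_eq_map_drun:
  assumes "T \<le> M"
  shows "run m R T cf = map_pmf (\<lambda>bs. fst (drun m R T (cf, bs))) (replicate_pmf M (bernoulli_pmf (1/2)))"
  using assms
proof (induction T arbitrary: cf M)
  case 0
  then show ?case by (simp add: drun_def)
next
  case (Suc T)
  obtain c r h where cf: "cf = (c, r, h)" by (cases cf)
  from step_cases[of m R c r h] show ?case
  proof (elim disjE exE conjE)
    fix cf' assume *: "step m R (c, r, h) = return_pmf cf'"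
      "\<forall>bs. dstep m R ((c, r, h), bs) = (cf', bs)"
    then show ?thesis using Suc.IH[of M cf'] Suc.prems
      by (simp add: cf bind_return_pmf drun_def funpow_Suc_right del: funpow.simps)
  next
    fix F assume *: "step m R (c, r, h) = map_pmf F (bernoulli_pmf (1/2))"
      "\<forall>b bs. dstep m R ((c, r, h), b # bs) = (F b, bs)"
    obtain M' where M: "M = Suc M'" "T \<le> M'" using Suc.prems by (cases M) auto
    have "run m R (Suc T) cf = bind_pmf (bernoulli_pmf (1/2)) (\<lambda>b. run m R T (F b))"
      by (simp add: cf * bind_map_pmf)
    also have "\<dots> = map_pmf (\<lambda>bs. fst (drun m R (Suc T) (cf, bs))) (replicate_pmf M (bernoulli_pmf (1/2)))"
      unfolding M replicate_pmf.simps map_bind_pmf Suc.IH[OF M(2)]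
      by (simp add: cf drun_def funpow_Suc_right * map_pmf_def bind_assoc_pmf bind_return_pmf
          del: funpow.simps)
    finally show ?thesis .
  qed
qed

lemma drun_Suc: "drun m R (Suc t) s = drun m R t (dstep m R s)"
  by (simp add: drun_def funpow_Suc_right del: funpow.simps)

lemma drun_add: "drun m R (t + t') s = drun m R t' (drun m R t s)"
  by (simp add: drun_def funpow_add add.commute[of t])

lemma drun_0 [simp]: "drun m R 0 s = s"
  by (simp add: drun_def)

lemma drun_Skip [simp]: "drun m R t ((Skip, s), bs) = ((Skip, s), bs)"
  by (cases s, induction t) (auto simp: drun_Suc)

text \<open>A finished command idles on \<open>Skip\<close>, so \<open>t\<close> may exceed the time
  that \<open>c1\<close> really takes; \<open>t'\<close> is that real time. The additional step
  removes the finished \<open>Skip\<close> from the sequence.\<close>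

lemma drun_Seq:
  assumes "drun m R t ((c1, s), bs) = ((Skip, s'), bs')"
  shows "\<exists>t'\<le>t. drun m R (Suc t') ((Seq c1 c2, s), bs) = ((c2, s'), bs')"
  using assms
proof (induction t arbitrary: c1 s bs)
  case 0
  then show ?case by (cases s) (auto simp: drun_Suc)
next
  case (Suc t)
  show ?case
  proof (cases "c1 = Skip")
    case True
    then show ?thesis using Suc.prems by (intro exI[of _ 0], cases s) (auto simp: drun_Suc)
  next
    case False
    obtain c s1 bs1 where 1: "dstep m R ((c1, s), bs) = ((c, s1), bs1)"
      by (metis prod.collapse)
    then have "drun m R t ((c, s1), bs1) = ((Skip, s'), bs')"
      using Suc.prems by (simp add: drun_Suc)
    from Suc.IH[OF this] obtain t' where t': "t' \<le> t"
      "drun m R (Suc t') ((Seq c c2, s1), bs1) = ((c2, s'), bs')" by blast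
    have "dstep m R ((Seq c1 c2, s), bs) = ((Seq c c2, s1), bs1)"
      using False 1 by (cases s) simp
    then have "drun m R (Suc (Suc t')) ((Seq c1 c2, s), bs) = ((c2, s'), bs')"
      using t'(2) by (subst drun_Suc) simp
    then show ?thesis using t'(1) by (intro exI[of _ "Suc t'"]) simp
  qed
qed

type_synonym store = "(nat \<Rightarrow> nat) \<times> (nat \<Rightarrow> nat) \<times> bits"

text \<open>Total correctness within a time limit. The time is only bounded, so limits can be
  weakened freely; the postcondition sees the unread coins, so an invariant can record how many have
  been consumed.\<close>

definition reaches :: "nat \<Rightarrow> bits ring \<Rightarrow> com \<Rightarrow> nat \<Rightarrow> (store \<Rightarrow> bool) \<Rightarrow> store \<Rightarrow> bool" where
  "reaches m R c t Q = (\<lambda>(r, h, bs). \<exists>t'\<le>t. \<exists>r' h' bs'.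
     drun m R t' ((c, r, h), bs) = ((Skip, r', h'), bs') \<and> Q (r', h', bs'))"

lemma reaches_mono:
  assumes "reaches m R c t Q s" "t \<le> t'" "\<And>s. Q s \<Longrightarrow> Q' s"
  shows "reaches m R c t' Q' s"
proof -
  obtain r h bs where s: "s = (r, h, bs)" by (cases s)
  show ?thesis using assms unfolding reaches_def s prod.case by (meson le_trans)
qed

lemma reaches_atomic:
  assumes "dstep m R ((c, r, h), bs) = ((Skip, r', h'), bs')" "Q (r', h', bs')" "0 < t"
  shows "reaches m R c t Q (r, h, bs)"
proof -
  have "drun m R 1 ((c, r, h), bs) = ((Skip, r', h'), bs')"
    using assms(1) by (simp add: drun_Suc)
  moreover have "1 \<le> t" using assms(3) by simp
  ultimately show ?thesis unfolding reaches_def prod.case using assms(2) by blast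
qed

lemma reaches_Skip: "Q s \<Longrightarrow> reaches m R Skip t Q s"
proof -
  assume "Q s"
  obtain r h bs where s: "s = (r, h, bs)" by (cases s)
  show ?thesis unfolding reaches_def s prod.case using \<open>Q s\<close> drun_Skip s zero_le by blast
qed

lemma reaches_Seq:
  assumes "reaches m R c1 t1 (reaches m R c2 t2 Q) s" "t1 + t2 + 1 \<le> t"
  shows "reaches m R (Seq c1 c2) t Q s"
proof -
  obtain r h bs where s: "s = (r, h, bs)" by (cases s)
  from assms(1) obtain t1' r1 h1 bs1 t2' r2 h2 bs2 where
    1: "t1' \<le> t1" "drun m R t1' ((c1, r, h), bs) = ((Skip, r1, h1), bs1)" and
    2: "t2' \<le> t2" "drun m R t2' ((c2, r1, h1), bs1) = ((Skip, r2, h2), bs2)" "Q (r2, h2, bs2)"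
    unfolding reaches_def s by auto
  from drun_Seq[OF 1(2), of c2] obtain t' where t': "t' \<le> t1'"
    "drun m R (Suc t') ((Seq c1 c2, r, h), bs) = ((c2, r1, h1), bs1)" by auto
  then have "drun m R (Suc t' + t2') ((Seq c1 c2, r, h), bs) = ((Skip, r2, h2), bs2)"
    using 2 by (simp add: drun_add del: add_Suc)
  moreover have "Suc t' + t2' \<le> t" using 1 2 t' assms(2) by simp
  ultimately show ?thesis unfolding reaches_def s prod.case using 2(3) by blast
qed

lemma reaches_step:
  assumes "dstep m R ((c, r, h), bs) = ((c', r', h'), bs')" "reaches m R c' t' Q (r', h', bs')" "t' < t"
  shows "reaches m R c t Q (r, h, bs)"
proof -
  from assms(2) obtain t1 r1 h1 bs1 where "t1 \<le> t'"
    "drun m R t1 ((c', r', h'), bs') = ((Skip, r1, h1), bs1)" "Q (r1, h1, bs1)"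
    unfolding reaches_def by auto
  then have "drun m R (Suc t1) ((c, r, h), bs) = ((Skip, r1, h1), bs1)" "Suc t1 \<le> t"
    "Q (r1, h1, bs1)"
    using assms(1,3) by (auto simp: drun_Suc)
  then show ?thesis unfolding reaches_def prod.case by blast
qed

lemma reaches_IfLess:
  assumes "r x < r y \<Longrightarrow> reaches m R c1 t Q (r, h, bs)"
    and "\<not> r x < r y \<Longrightarrow> reaches m R c2 t Q (r, h, bs)" and "t < t'"
  shows "reaches m R (IfLess x y c1 c2) t' Q (r, h, bs)"
  by (rule reaches_step[where c' = "if r x < r y then c1 else c2"]) (use assms in auto)

text \<open>The number \<open>k\<close> of rounds is known beforehand, so the invariant is indexed
  by the round and no termination measure is needed. Each round costs two steps besides the body,
  the test and the removal of a finished \<open>Skip\<close>; the strict inequality leaves one step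
  for the last, failing test.\<close>

lemma reaches_WhileLess:
  assumes body: "\<And>j r h bs. j < k \<Longrightarrow> I j (r, h, bs) \<Longrightarrow> r x < r y \<and> reaches m R c b (I (Suc j)) (r, h, bs)"
    and exit: "\<And>r h bs. I k (r, h, bs) \<Longrightarrow> \<not> r x < r y \<and> Q (r, h, bs)"
    and init: "I j s" "j \<le> k" and t: "(k - j) * (b + 2) < t"
  shows "reaches m R (WhileLess x y c) t Q s"
  using init t
proof (induction "k - j" arbitrary: j s t)
  case 0
  obtain r h bs where s: "s = (r, h, bs)" by (cases s)
  with 0 have "I k (r, h, bs)" by simp
  from exit[OF this] show ?case unfolding s using 0
    by (intro reaches_atomic[of _ _ _ _ _ _ r h bs]) auto
next
  case (Suc l)
  obtain r h bs where s: "s = (r, h, bs)" by (cases s)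
  have j: "j < k" using Suc by simp
  have le: "(k - j) * (b + 2) = (k - Suc j) * (b + 2) + b + 2"
    using j by (metis Suc_diff_Suc add.commute add.assoc mult_Suc)
  have *: "reaches m R c b (I (Suc j)) s" "r x < r y"
    using body[OF j, of r h bs] Suc.prems s by auto
  have "reaches m R (Seq c (WhileLess x y c)) (b + ((k - Suc j) * (b + 2) + 1) + 1) Q s"
    by (rule reaches_Seq[OF reaches_mono[OF *(1)]])
       (use Suc.hyps j in \<open>auto intro!: Suc.hyps(1)\<close>)
  then show ?case unfolding s
    by (rule reaches_step[rotated]) (use * le Suc.prems in auto)
qed

section \<open>Compiling arithmetic expressions for a machine without multiplication and
  division\<close>

datatype aexp = Num nat | Var nat | Plus aexp aexp | Minus aexp aexp | Times aexp aexp
  | Div aexp aexp | Mem aexp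

primrec aval :: "aexp \<Rightarrow> (nat \<Rightarrow> nat) \<Rightarrow> (nat \<Rightarrow> nat) \<Rightarrow> nat" where
  "aval (Num c) r h = c"
| "aval (Var x) r h = r x"
| "aval (Plus a b) r h = aval a r h + aval b r h"
| "aval (Minus a b) r h = aval a r h - aval b r h"
| "aval (Times a b) r h = aval a r h * aval b r h"
| "aval (Div a b) r h = aval a r h div aval b r h"
| "aval (Mem a) r h = h (aval a r h)"

text \<open>The code for an expression leaves its value in register \<open>k\<close> and uses only \<open>k\<close> and later registers
  as scratch space.\<close>

primrec compile :: "aexp \<Rightarrow> nat \<Rightarrow> com" where
  "compile (Num c) k = SetConst k c"
| "compile (Var x) k = Seq (SetConst k 0) (AddReg k k x)"
| "compile (Plus a b) k = Seq (compile a k) (Seq (compile b (k+1)) (AddReg k k (k+1)))"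
| "compile (Minus a b) k = Seq (compile a k) (Seq (compile b (k+1)) (SubReg k k (k+1)))"
| "compile (Times a b) k = Seq (compile a k) (Seq (compile b (k+1))
     (Seq (SetConst (k+2) 0) (Seq (SetConst (k+3) 0) (Seq (SetConst (k+4) 1)
     (Seq (WhileLess (k+3) (k+1) (Seq (AddReg (k+2) (k+2) k) (AddReg (k+3) (k+3) (k+4))))
     (Seq (SetConst k 0) (AddReg k k (k+2))))))))"
| "compile (Div a b) k = Seq (compile a k) (Seq (compile b (k+1))
     (Seq (SetConst (k+2) 1) (Seq (SetConst (k+3) 0) (Seq (AddReg k k (k+2))
     (Seq (WhileLess (k+1) k (Seq (SubReg k k (k+1)) (AddReg (k+3) (k+3) (k+2))))
     (Seq (SetConst k 0) (AddReg k k (k+3))))))))"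
| "compile (Mem a) k = Seq (compile a k) (Load k k)"

primrec vars_below :: "nat \<Rightarrow> aexp \<Rightarrow> bool" where
  "vars_below k (Num c) \<longleftrightarrow> True"
| "vars_below k (Var x) \<longleftrightarrow> x < k"
| "vars_below k (Plus a b) \<longleftrightarrow> vars_below k a \<and> vars_below k b"
| "vars_below k (Minus a b) \<longleftrightarrow> vars_below k a \<and> vars_below k b"
| "vars_below k (Times a b) \<longleftrightarrow> vars_below k a \<and> vars_below k b"
| "vars_below k (Div a b) \<longleftrightarrow> vars_below k a \<and> vars_below k b"
| "vars_below k (Mem a) \<longleftrightarrow> vars_below k a"

text \<open>\<open>B\<close> bounds the number of iterations of each multiplication loop (the second factor) and of each
  division loop (at most the dividend).\<close>

primrec cheap :: "nat \<Rightarrow> aexp \<Rightarrow> (nat \<Rightarrow> nat) \<Rightarrow> (nat \<Rightarrow> nat) \<Rightarrow> bool" where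
  "cheap B (Num c) r h \<longleftrightarrow> True"
| "cheap B (Var x) r h \<longleftrightarrow> True"
| "cheap B (Plus a b) r h \<longleftrightarrow> cheap B a r h \<and> cheap B b r h"
| "cheap B (Minus a b) r h \<longleftrightarrow> cheap B a r h \<and> cheap B b r h"
| "cheap B (Times a b) r h \<longleftrightarrow> cheap B a r h \<and> cheap B b r h \<and> aval b r h \<le> B"
| "cheap B (Div a b) r h \<longleftrightarrow> cheap B a r h \<and> cheap B b r h \<and> 0 < aval b r h \<and> aval a r h \<le> B"
| "cheap B (Mem a) r h \<longleftrightarrow> cheap B a r h"

primrec nodes :: "aexp \<Rightarrow> nat" where
  "nodes (Num c) = 1"
| "nodes (Var x) = 1"
| "nodes (Plus a b) = nodes a + nodes b + 1"
| "nodes (Minus a b) = nodes a + nodes b + 1"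
| "nodes (Times a b) = nodes a + nodes b + 1"
| "nodes (Div a b) = nodes a + nodes b + 1"
| "nodes (Mem a) = nodes a + 1"

lemma aval_cong: "vars_below k a \<Longrightarrow> \<forall>x<k. r x = r' x \<Longrightarrow> aval a r h = aval a r' h"
  by (induction a) auto

lemma cheap_cong: "vars_below k a \<Longrightarrow> \<forall>x<k. r x = r' x \<Longrightarrow> cheap B a r h = cheap B a r' h"
  by (induction a) (auto dest: aval_cong[of _ _ r r' h])

lemma vars_below_mono: "vars_below k a \<Longrightarrow> k \<le> k' \<Longrightarrow> vars_below k' a"
  by (induction a) auto

text \<open>The right operand is computed with scratch registers from \<open>k+1\<close> on, so the
  value of the left operand in register \<open>k\<close> survives. The hypotheses hold for every
  postcondition because the two evaluations are nested, one inside the postcondition of the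
  other.\<close>

lemma compile_binary:
  assumes a: "\<And>Q. (\<And>r'. r' k = va \<Longrightarrow> \<forall>x<k. r' x = r x \<Longrightarrow> Q (r', h, bs)) \<Longrightarrow>
      reaches m R ca ta Q (r, h, bs)"
    and b: "\<And>r' Q. \<forall>x<k. r' x = r x \<Longrightarrow>
      (\<And>r''. r'' (k+1) = vb \<Longrightarrow> \<forall>x<k+1. r'' x = r' x \<Longrightarrow> Q (r'', h, bs)) \<Longrightarrow>
      reaches m R cb tb Q (r', h, bs)"
    and c: "\<And>r'. r' k = va \<Longrightarrow> r' (k+1) = vb \<Longrightarrow> \<forall>x<k. r' x = r x \<Longrightarrow> reaches m R c tc Q (r', h, bs)"
    and t: "ta + tb + tc + 2 \<le> t"
  shows "reaches m R (Seq ca (Seq cb c)) t Q (r, h, bs)"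
proof (rule reaches_Seq)
  show "reaches m R ca ta (reaches m R (Seq cb c) (tb + tc + 1) Q) (r, h, bs)"
  proof (rule a)
    fix r' assume r': "r' k = va" "\<forall>x<k. r' x = r x"
    show "reaches m R (Seq cb c) (tb + tc + 1) Q (r', h, bs)"
    proof (rule reaches_Seq)
      show "reaches m R cb tb (reaches m R c tc Q) (r', h, bs)"
        by (rule b) (use r' in \<open>auto intro!: c\<close>)
    qed simp
  qed
qed (use t in simp)

text \<open>A node costs at most \<open>5 * B + 30\<close> steps: a loop body of two instructions
  takes 3, the loop itself adds 2 per round, and \<open>cheap\<close> limits the rounds to
  \<open>B\<close>.\<close>

lemma reaches_compile:
  assumes "vars_below k e" "cheap B e r h"
    and "\<And>r'. r' k = aval e r h \<Longrightarrow> \<forall>x<k. r' x = r x \<Longrightarrow> Q (r', h, bs)"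
    and "nodes e * (5 * B + 30) \<le> t"
  shows "reaches m R (compile e k) t Q (r, h, bs)"
  using assms
proof (induction e arbitrary: k r Q t)
  case (Num c)
  then show ?case by (auto intro!: reaches_atomic)
next
  case (Var x)
  show ?case unfolding compile.simps
    by (rule reaches_Seq[of _ _ _ 1 _ 1] reaches_atomic dstep.simps)+
      (use Var in auto)
next
  case (Plus a b)
  have *: "vars_below (k+1) b" using Plus.prems vars_below_mono[of k b "k+1"] by auto
  have "reaches m R (Seq (compile a k) (Seq (compile b (k+1)) (AddReg k k (k+1)))) t Q (r, h, bs)"
  proof (rule compile_binary)
    show "reaches m R (compile a k) (nodes a * (5*B+30)) Q' (r, h, bs)"
      if "\<And>r'. r' k = aval a r h \<Longrightarrow> \<forall>x<k. r' x = r x \<Longrightarrow> Q' (r', h, bs)" for Q'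
      by (rule Plus.IH(1)) (use Plus.prems that in auto)
    show "reaches m R (compile b (k+1)) (nodes b * (5*B+30)) Q' (r', h, bs)"
      if "\<forall>x<k. r' x = r x"
         "\<And>r''. r'' (k+1) = aval b r h \<Longrightarrow> \<forall>x<k+1. r'' x = r' x \<Longrightarrow> Q' (r'', h, bs)" for r' Q'
      by (rule Plus.IH(2))
        (use Plus.prems that * aval_cong[of k b r' r h] cheap_cong[of k b r' r B h] in auto)
    show "reaches m R (AddReg k k (k+1)) 1 Q (r', h, bs)"
      if "r' k = aval a r h" "r' (k+1) = aval b r h" "\<forall>x<k. r' x = r x" for r'
      by (rule reaches_atomic, rule dstep.simps) (use Plus.prems that in auto)
  qed (use Plus.prems in \<open>auto simp: algebra_simps\<close>)
  then show ?case by simp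
next
  case (Minus a b)
  have *: "vars_below (k+1) b" using Minus.prems vars_below_mono[of k b "k+1"] by auto
  have "reaches m R (Seq (compile a k) (Seq (compile b (k+1)) (SubReg k k (k+1)))) t Q (r, h, bs)"
  proof (rule compile_binary)
    show "reaches m R (compile a k) (nodes a * (5*B+30)) Q' (r, h, bs)"
      if "\<And>r'. r' k = aval a r h \<Longrightarrow> \<forall>x<k. r' x = r x \<Longrightarrow> Q' (r', h, bs)" for Q'
      by (rule Minus.IH(1)) (use Minus.prems that in auto)
    show "reaches m R (compile b (k+1)) (nodes b * (5*B+30)) Q' (r', h, bs)"
      if "\<forall>x<k. r' x = r x"
         "\<And>r''. r'' (k+1) = aval b r h \<Longrightarrow> \<forall>x<k+1. r'' x = r' x \<Longrightarrow> Q' (r'', h, bs)" for r' Q'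
      by (rule Minus.IH(2))
        (use Minus.prems that * aval_cong[of k b r' r h] cheap_cong[of k b r' r B h] in auto)
    show "reaches m R (SubReg k k (k+1)) 1 Q (r', h, bs)"
      if "r' k = aval a r h" "r' (k+1) = aval b r h" "\<forall>x<k. r' x = r x" for r'
      by (rule reaches_atomic, rule dstep.simps) (use Minus.prems that in auto)
  qed (use Minus.prems in \<open>auto simp: algebra_simps\<close>)
  then show ?case by simp
next
  case (Times a b)
  have *: "vars_below (k+1) b" using Times.prems vars_below_mono[of k b "k+1"] by auto
  let ?I = "\<lambda>j (r', h', bs'). r' k = aval a r h \<and> r' (k+1) = aval b r h \<and> (\<forall>x<k. r' x = r x) \<and>
     r' (k+2) = j * aval a r h \<and> r' (k+3) = j \<and> r' (k+4) = 1 \<and> h' = h \<and> bs' = bs"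
  show ?case unfolding compile.simps
  proof (rule compile_binary)
    show "reaches m R (compile a k) (nodes a * (5*B+30)) Q' (r, h, bs)"
      if "\<And>r'. r' k = aval a r h \<Longrightarrow> \<forall>x<k. r' x = r x \<Longrightarrow> Q' (r', h, bs)" for Q'
      by (rule Times.IH(1)) (use Times.prems that in auto)
    show "reaches m R (compile b (k+1)) (nodes b * (5*B+30)) Q' (r', h, bs)"
      if "\<forall>x<k. r' x = r x"
         "\<And>r''. r'' (k+1) = aval b r h \<Longrightarrow> \<forall>x<k+1. r'' x = r' x \<Longrightarrow> Q' (r'', h, bs)" for r' Q'
      by (rule Times.IH(2))
        (use Times.prems that * aval_cong[of k b r' r h] cheap_cong[of k b r' r B h] in auto)
    show "reaches m R (Seq (SetConst (k+2) 0) (Seq (SetConst (k+3) 0) (Seq (SetConst (k+4) 1)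
       (Seq (WhileLess (k+3) (k+1) (Seq (AddReg (k+2) (k+2) k) (AddReg (k+3) (k+3) (k+4))))
       (Seq (SetConst k 0) (AddReg k k (k+2))))))) (5 * B + 28) Q (r', h, bs)"
      if "r' k = aval a r h" "r' (k+1) = aval b r h" "\<forall>x<k. r' x = r x" for r'
      apply (rule reaches_Seq[of _ _ _ 1 _ "5*B+25"], rule reaches_atomic, rule dstep.simps)
        apply (rule reaches_Seq[of _ _ _ 1 _ "5*B+20"], rule reaches_atomic, rule dstep.simps)
          apply (rule reaches_Seq[of _ _ _ 1 _ "5*B+15"], rule reaches_atomic, rule dstep.simps)
            apply (rule reaches_Seq[of _ _ _ "5*B+1" _ "5"])
             apply (rule reaches_WhileLess[where I = ?I and k = "aval b r h" and j = 0 and b = 3])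
      subgoal for j r h bs
        apply clarsimp
        apply (rule reaches_Seq[of _ _ _ 1 _ 1] reaches_atomic dstep.simps)+
        by auto
      subgoal for r'' h'' bs''
        apply clarsimp
        apply (rule reaches_Seq[of _ _ _ 1 _ 1] reaches_atomic dstep.simps)+
        using Times.prems by (auto simp: mult.commute)
      using that Times.prems by auto
  qed (use Times.prems in \<open>auto simp: algebra_simps\<close>)
next
  case (Div a b)
  have *: "vars_below (k+1) b" using Div.prems vars_below_mono[of k b "k+1"] by auto
  let ?va = "aval a r h" let ?vb = "aval b r h"
  \<comment> \<open>The code has added 1 to the dividend, so the strict test of the loop says that
    the divisor still fits into what is left.\<close>
  let ?I = "\<lambda>j (r', h', bs'). r' k = ?va + 1 - j * ?vb \<and> r' (k+1) = ?vb \<and> (\<forall>x<k. r' x = r x) \<and>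
     r' (k+2) = 1 \<and> r' (k+3) = j \<and> h' = h \<and> bs' = bs"
  have vb: "0 < ?vb" "?va \<le> B" using Div.prems by auto
  have dv: "?va div ?vb \<le> B" using vb(2) div_le_dividend[of ?va ?vb] by (rule order_trans[rotated])
  have lt: "?vb < ?va + 1 - j * ?vb" if "j < ?va div ?vb" for j
  proof -
    have "Suc j * ?vb \<le> ?va" using that vb by (metis Suc_leI div_times_less_eq_dividend le_trans mult_le_mono1)
    then show ?thesis by simp
  qed
  have nlt: "\<not> ?vb < ?va + 1 - ?va div ?vb * ?vb"
    using mod_less_divisor[OF vb(1), of ?va] minus_div_mult_eq_mod[of ?va ?vb] by linarith
  show ?case unfolding compile.simps
  proof (rule compile_binary)
    show "reaches m R (compile a k) (nodes a * (5*B+30)) Q' (r, h, bs)"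
      if "\<And>r'. r' k = aval a r h \<Longrightarrow> \<forall>x<k. r' x = r x \<Longrightarrow> Q' (r', h, bs)" for Q'
      by (rule Div.IH(1)) (use Div.prems that in auto)
    show "reaches m R (compile b (k+1)) (nodes b * (5*B+30)) Q' (r', h, bs)"
      if "\<forall>x<k. r' x = r x"
         "\<And>r''. r'' (k+1) = aval b r h \<Longrightarrow> \<forall>x<k+1. r'' x = r' x \<Longrightarrow> Q' (r'', h, bs)" for r' Q'
      by (rule Div.IH(2))
        (use Div.prems that * aval_cong[of k b r' r h] cheap_cong[of k b r' r B h] in auto)
    show "reaches m R (Seq (SetConst (k+2) 1) (Seq (SetConst (k+3) 0) (Seq (AddReg k k (k+2))
       (Seq (WhileLess (k+1) k (Seq (SubReg k k (k+1)) (AddReg (k+3) (k+3) (k+2))))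
       (Seq (SetConst k 0) (AddReg k k (k+3))))))) (5 * B + 28) Q (r', h, bs)"
      if "r' k = aval a r h" "r' (k+1) = aval b r h" "\<forall>x<k. r' x = r x" for r'
      apply (rule reaches_Seq[of _ _ _ 1 _ "5*B+25"], rule reaches_atomic, rule dstep.simps)
        apply (rule reaches_Seq[of _ _ _ 1 _ "5*B+20"], rule reaches_atomic, rule dstep.simps)
          apply (rule reaches_Seq[of _ _ _ 1 _ "5*B+15"], rule reaches_atomic, rule dstep.simps)
            apply (rule reaches_Seq[of _ _ _ "5*B+1" _ "5"])
             apply (rule reaches_WhileLess[where I = ?I and k = "?va div ?vb" and j = 0 and b = 3])
      subgoal for j r h bs
        using lt[of j] apply clarsimp
        apply (rule reaches_Seq[of _ _ _ 1 _ 1] reaches_atomic dstep.simps)+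
        by auto
      subgoal for r'' h'' bs''
        using nlt apply clarsimp
        apply (rule reaches_Seq[of _ _ _ 1 _ 1] reaches_atomic dstep.simps)+
        using Div.prems by auto
      using that Div.prems dv by auto
  qed (use Div.prems in \<open>auto simp: algebra_simps\<close>)
next
  case (Mem a)
  show ?case unfolding compile.simps
    apply (rule reaches_Seq[of _ _ _ "nodes a * (5 * B + 30)" _ 1])
     apply (rule Mem.IH)
    using Mem.prems by (auto intro!: reaches_atomic)
qed

section \<open>Random tables\<close>

text \<open>Union bound for a two-stage experiment: \<open>B\<close> is the event that the first
  stage already goes wrong, and outside it the second stage fails with probability at most
  \<open>e\<close>.\<close>

lemma prob_bind_le:
  assumes "\<And>x. x \<in> set_pmf p \<Longrightarrow> x \<notin> B \<Longrightarrow> measure_pmf.prob (f x) A \<le> e" "0 \<le> e"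
  shows "measure_pmf.prob (bind_pmf p f) A \<le> measure_pmf.prob p B + e"
proof -
  have "emeasure (bind_pmf p f) A = (\<integral>\<^sup>+x. emeasure (f x) A \<partial>p)" by simp
  also have "\<dots> \<le> (\<integral>\<^sup>+x. indicator B x + ennreal e \<partial>p)"
  proof (rule nn_integral_mono_AE, unfold AE_measure_pmf_iff, intro ballI)
    fix x assume x: "x \<in> set_pmf p"
    show "emeasure (f x) A \<le> indicator B x + ennreal e"
    proof (cases "x \<in> B")
      case True
      then show ?thesis using measure_pmf.emeasure_le_1[of "f x" A] by (simp add: add_increasing2)
    next
      case False
      then show ?thesis using assms x by (simp add: measure_pmf.emeasure_eq_measure ennreal_leI)
    qed
  qed
  also have "\<dots> = ennreal (measure_pmf.prob p B + e)"
    using assms(2) by (simp add: nn_integral_add measure_pmf.emeasure_eq_measure ennreal_plus)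
  finally show ?thesis
    using assms(2) by (simp add: measure_pmf.emeasure_eq_measure flip: ennreal_plus)
qed

text \<open>The most significant bit comes first, unlike in \<open>encode_bits\<close>: this is the
  order in which coins enter an accumulator that is doubled before each addition.\<close>

definition horner_bits :: "nat \<Rightarrow> bits \<Rightarrow> nat" where
  "horner_bits = foldl (\<lambda>a b. a + a + of_bool b)"

primrec chunks :: "nat \<Rightarrow> nat \<Rightarrow> bits \<Rightarrow> nat list" where
  "chunks l 0 bs = []"
| "chunks l (Suc J) bs = horner_bits 0 (take l bs) # chunks l J (drop l bs)"

lemma length_chunks [simp]: "length (chunks l J bs) = J"
  by (induction J arbitrary: bs) auto

lemma chunks_nth: "j < J \<Longrightarrow> chunks l J bs ! j = horner_bits 0 (take l (drop (j * l) bs))"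
proof (induction J arbitrary: bs j)
  case (Suc J)
  then show ?case by (cases j) (auto simp: add.commute)
qed simp

lemma horner_bits_less: "horner_bits a bs < (a + 1) * 2 ^ length bs"
proof (induction bs arbitrary: a)
  case (Cons b bs)
  have "horner_bits a (b # bs) < (a + a + of_bool b + 1) * 2 ^ length bs"
    using Cons[of "a + a + of_bool b"] by (simp add: horner_bits_def)
  also have "\<dots> \<le> (a + a + 1 + 1) * 2 ^ length bs" by (intro mult_le_mono1) simp
  finally show ?case by (simp add: algebra_simps)
qed (simp add: horner_bits_def)

lemma chunks_less:
  assumes "j < J"
  shows "chunks l J bs ! j < 2 ^ l"
proof -
  have "horner_bits 0 (take l (drop (j * l) bs)) < 2 ^ length (take l (drop (j * l) bs))"
    using horner_bits_less[of 0 "take l (drop (j * l) bs)"] by simp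
  also have "\<dots> \<le> 2 ^ l" by simp
  finally show ?thesis using assms by (simp add: chunks_nth)
qed

text \<open>The first bit selects one of the two halves of the interval, and a fair choice of a half
  followed by a uniform choice inside it is uniform. The start value is general because every bit
  changes it.\<close>

lemma map_horner_bits_replicate_pmf:
  "map_pmf (horner_bits a) (replicate_pmf l (bernoulli_pmf (1/2))) = pmf_of_set {a * 2 ^ l..<(a + 1) * 2 ^ l}"
proof (induction l arbitrary: a)
  case 0
  then show ?case by (simp add: horner_bits_def pmf_of_set_singleton)
next
  case (Suc l)
  let ?f = "\<lambda>b. {(a + a + of_bool b) * 2 ^ l..<(a + a + of_bool b + 1) * (2::nat) ^ l}"
  have "map_pmf (horner_bits a) (replicate_pmf (Suc l) (bernoulli_pmf (1/2))) =
     bind_pmf (bernoulli_pmf (1/2)) (\<lambda>b. map_pmf (horner_bits (a + a + of_bool b)) (replicate_pmf l (bernoulli_pmf (1/2))))"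
    by (simp add: map_bind_pmf map_pmf_def bind_assoc_pmf bind_return_pmf horner_bits_def)
  also have "\<dots> = bind_pmf (pmf_of_set UNIV) (\<lambda>b. pmf_of_set (?f b))"
    unfolding Suc.IH by (simp add: bernoulli_pmf_half_conv_pmf_of_set)
  also have "\<dots> = pmf_of_set (\<Union>b. ?f b)"
    by (rule pmf_of_set_UN[where n = "2^l", symmetric])
      (auto simp: disjoint_family_on_def algebra_simps)
  also have "(\<Union>b. ?f b) = {a * 2 ^ Suc l..<(a + 1) * 2 ^ Suc l}"
    by (auto simp: UNIV_bool algebra_simps)
  finally show ?case .
qed

text \<open>The entries come from disjoint blocks of coins and are therefore independent; the coins
  after the last block integrate away.\<close>

lemma map_chunks_replicate_pmf:
  assumes "J * l \<le> M"
  shows "map_pmf (chunks l J) (replicate_pmf M (bernoulli_pmf (1/2))) = replicate_pmf J (pmf_of_set {..<2^l})"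
  using assms
proof (induction J arbitrary: M)
  case 0
  then show ?case by (simp add: map_pmf_const)
next
  case (Suc J)
  let ?c = "bernoulli_pmf (1/2)"
  define M' where "M' = M - l"
  have M: "M = l + M'" "J * l \<le> M'" using Suc.prems by (auto simp: M'_def)
  have "map_pmf (chunks l (Suc J)) (replicate_pmf M ?c) =
    bind_pmf (replicate_pmf l ?c) (\<lambda>xs. bind_pmf (replicate_pmf M' ?c) (\<lambda>ys. return_pmf (chunks l (Suc J) (xs @ ys))))"
    by (simp add: M replicate_pmf_distrib map_bind_pmf)
  also have "\<dots> = bind_pmf (replicate_pmf l ?c) (\<lambda>xs. bind_pmf (replicate_pmf M' ?c)
       (\<lambda>ys. return_pmf (horner_bits 0 xs # chunks l J ys)))"
    by (intro bind_pmf_cong refl) (auto simp: set_replicate_pmf)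
  also have "\<dots> = bind_pmf (map_pmf (horner_bits 0) (replicate_pmf l ?c)) (\<lambda>x.
       bind_pmf (map_pmf (chunks l J) (replicate_pmf M' ?c)) (\<lambda>xs. return_pmf (x # xs)))"
    by (simp add: bind_map_pmf)
  also have "\<dots> = replicate_pmf (Suc J) (pmf_of_set {..<2^l})"
    by (simp add: map_horner_bits_replicate_pmf Suc.IH[OF M(2)] lessThan_atLeast0)
  finally show ?case .
qed

section \<open>Rearranging finite sums, and the probability that random placement makes them
  vanish\<close>

context abelian_monoid begin

lemma finsum_Sigma:
  assumes "finite I" "\<And>i. i \<in> I \<Longrightarrow> finite (A i)" "\<And>i a. i \<in> I \<Longrightarrow> a \<in> A i \<Longrightarrow> g (i, a) \<in> carrier G"
  shows "(\<Oplus>i\<in>I. \<Oplus>a\<in>A i. g (i, a)) = (\<Oplus>x\<in>Sigma I A. g x)"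
proof -
  have "(\<Oplus>x\<in>(\<Union>i\<in>I. Pair i ` A i). g x) = (\<Oplus>i\<in>I. \<Oplus>x\<in>Pair i ` A i. g x)"
    by (rule add.finprod_UN_disjoint) (use assms in \<open>auto simp: pairwise_def disjnt_def\<close>)
  also have "\<dots> = (\<Oplus>i\<in>I. \<Oplus>a\<in>A i. g (i, a))"
    by (intro finsum_cong' refl finsum_reindex finsum_closed) (use assms in \<open>auto simp: inj_on_def\<close>)
  also have "(\<Union>i\<in>I. Pair i ` A i) = Sigma I A" by auto
  finally show ?thesis by simp
qed

lemma finsum_bij_betw:
  assumes "bij_betw h A B" "g \<in> B \<rightarrow> carrier G" "\<And>x. x \<in> A \<Longrightarrow> f x = g (h x)"
  shows "(\<Oplus>x\<in>A. f x) = (\<Oplus>y\<in>B. g y)"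
proof -
  have "(\<Oplus>y\<in>h ` A. g y) = (\<Oplus>x\<in>A. g (h x))"
    by (rule finsum_reindex) (use assms in \<open>auto simp: bij_betw_def\<close>)
  also have "\<dots> = (\<Oplus>x\<in>A. f x)"
    by (rule finsum_cong') (use assms in \<open>auto simp: bij_betw_def\<close>)
  finally show ?thesis using assms by (simp add: bij_betw_def)
qed

end

text \<open>Items \<open>res j\<close> are thrown into \<open>K\<close> buckets with initial
  contents \<open>A0\<close>. The last nonzero item decides: if two targets \<open>x\<close> and
  \<open>y\<close> for it both made all buckets zero, bucket \<open>x\<close> would be zero with the
  item and without it. The initial contents are arbitrary because the induction throws the first
  item and has to remember where it landed.\<close>

lemma (in abelian_group) prob_bucket_sums_zero:
  fixes K :: nat
  assumes "0 < K" "j0 < J" "res j0 \<noteq> \<zero>" "\<And>j. res j \<in> carrier G" "\<And>c. A0 c \<in> carrier G"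
  shows "measure_pmf.prob (replicate_pmf J (pmf_of_set {..<K}))
    {L. \<forall>c<K. A0 c \<oplus> (\<Oplus>j\<in>{j. j < J \<and> L ! j = c}. res j) = \<zero>} \<le> 1 / K"
  using assms(2-)
proof (induction J arbitrary: A0 res j0)
  case 0
  then show ?case by simp
next
  case (Suc J)
  let ?U = "pmf_of_set {..<K}"
  let ?E = "\<lambda>J (A0 :: nat \<Rightarrow> 'a) (res :: nat \<Rightarrow> 'a). {L. \<forall>c<K. A0 c \<oplus> (\<Oplus>j\<in>{j. j < J \<and> L ! j = c}. res j) = \<zero>}"
  define A1 where "A1 x c = A0 c \<oplus> (if x = c then res 0 else \<zero>)" for x c :: nat
  have A1: "A1 x c \<in> carrier G" for x c using Suc.prems by (auto simp: A1_def)
  have Cons: "A0 c \<oplus> (\<Oplus>j\<in>{j. j < Suc J \<and> (x # xs) ! j = c}. res j) =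
     A1 x c \<oplus> (\<Oplus>j\<in>{j. j < J \<and> xs ! j = c}. res (Suc j))" for x xs c
  proof -
    have "{j. j < Suc J \<and> (x # xs) ! j = c} =
        (if x = c then {0} else {}) \<union> Suc ` {j. j < J \<and> xs ! j = c}"
      by (force simp: less_Suc_eq_0_disj)
    also have "(\<Oplus>j\<in>\<dots>. res j) = (if x = c then res 0 else \<zero>) \<oplus> (\<Oplus>j\<in>Suc ` {j. j < J \<and> xs ! j = c}. res j)"
      by (subst finsum_Un_disjoint) (use Suc.prems in auto)
    also have "(\<Oplus>j\<in>Suc ` {j. j < J \<and> xs ! j = c}. res j) = (\<Oplus>j\<in>{j. j < J \<and> xs ! j = c}. res (Suc j))"
      by (rule finsum_reindex) (use Suc.prems in auto)
    finally show ?thesis using Suc.prems by (auto simp: A1_def a_assoc)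
  qed
  have eq: "measure_pmf.prob (bind_pmf (replicate_pmf J ?U) (\<lambda>xs. return_pmf (x # xs))) (?E (Suc J) A0 res) =
     measure_pmf.prob (replicate_pmf J ?U) (?E J (A1 x) (\<lambda>j. res (Suc j)))" for x
    unfolding map_pmf_def[symmetric] measure_map_pmf by (simp add: vimage_def Cons)
  show ?case
  proof (cases "\<exists>j1<J. res (Suc j1) \<noteq> \<zero>")
    case True
    then obtain j1 where j1: "j1 < J" "res (Suc j1) \<noteq> \<zero>" by blast
    \<comment> \<open>A nonzero item is still to come, so no outcome of the first throw is bad: the
      exceptional event is empty and the induction hypothesis bounds every conditional
      probability.\<close>
    have "measure_pmf.prob (replicate_pmf (Suc J) ?U) (?E (Suc J) A0 res) \<le> measure_pmf.prob ?U {} + 1 / K"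
      unfolding replicate_pmf.simps
    proof (rule prob_bind_le)
      fix x
      show "measure_pmf.prob (bind_pmf (replicate_pmf J ?U) (\<lambda>xs. return_pmf (x # xs))) (?E (Suc J) A0 res) \<le> 1 / K"
        unfolding eq by (rule Suc.IH) (use j1 Suc.prems A1 in auto)
    qed simp
    then show ?thesis by simp
  next
    case False
    \<comment> \<open>the last nonzero item is thrown now: all but at most one bucket leave a nonzero sum for good\<close>
    then have r0: "res 0 \<noteq> \<zero>" using Suc.prems(1,2) by (cases j0) auto
    have z: "(\<Oplus>j\<in>{j. j < J \<and> xs ! j = c}. res (Suc j)) = \<zero>" for xs c
      using False by (intro add.finprod_one_eqI) auto
    define B where "B = {x. x < K \<and> (\<forall>c<K. A1 x c = \<zero>)}"
    have sub: "x = y" if "x \<in> B" "y \<in> B" for x y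
    proof (rule ccontr)
      assume "x \<noteq> y"
      then have "A0 x \<oplus> res 0 = \<zero>" "A0 x \<oplus> \<zero> = \<zero>" using that unfolding B_def A1_def by force+
      then show False using r0 Suc.prems by simp
    qed
    have "measure_pmf.prob (replicate_pmf (Suc J) ?U) (?E (Suc J) A0 res) \<le> measure_pmf.prob ?U B + 0"
      unfolding replicate_pmf.simps
    proof (rule prob_bind_le)
      fix x assume "x \<in> set_pmf ?U" "x \<notin> B"
      then have *: "?E J (A1 x) (\<lambda>j. res (Suc j)) = {}"
        using \<open>0 < K\<close> A1 by (auto simp: B_def z set_pmf_of_set lessThan_empty_iff)
      then show "measure_pmf.prob (bind_pmf (replicate_pmf J ?U) (\<lambda>xs. return_pmf (x # xs))) (?E (Suc J) A0 res) \<le> 0"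
        unfolding eq * by simp
    qed simp
    also have "measure_pmf.prob ?U B = card ({..<K} \<inter> B) / K"
      using \<open>0 < K\<close> by (subst measure_pmf_of_set) (auto simp: lessThan_empty_iff)
    also have "card ({..<K} \<inter> B) \<le> 1"
      using sub by (simp add: card_le_Suc0_iff_eq)
    then have "card ({..<K} \<inter> B) / K + 0 \<le> 1 / real K" by (simp add: divide_right_mono)
    finally show ?thesis by simp
  qed
qed

text \<open>\<open>G v u\<close> is the coefficient of the word \<open>u\<close> in the polynomial waiting at state \<open>v\<close> of a layer.  Reading
  the first letter \<open>i\<close> at state \<open>v\<close> moves the rest of that polynomial to state \<open>L ! (v * n + i)\<close> of the next layer.\<close>

definition push :: "('a, 'b) ring_scheme \<Rightarrow> nat \<Rightarrow> nat \<Rightarrow> nat list \<Rightarrow> (nat \<Rightarrow> nat list \<Rightarrow> 'a) \<Rightarrow> nat \<Rightarrow> nat list \<Rightarrow> 'a" where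
  "push R K n L G c u = (\<Oplus>\<^bsub>R\<^esub>j\<in>{j. j < K * n \<and> L ! j = c}. G (j div n) ((j mod n) # u))"

primrec pushes :: "('a, 'b) ring_scheme \<Rightarrow> nat \<Rightarrow> nat \<Rightarrow> nat \<Rightarrow> nat list \<Rightarrow> (nat \<Rightarrow> nat list \<Rightarrow> 'a) \<Rightarrow> nat \<Rightarrow> nat list \<Rightarrow> 'a" where
  "pushes R K n 0 L G = G"
| "pushes R K n (Suc k) L G = pushes R K n k (drop (K * n) L) (push R K n L G)"

text \<open>For a fixed rest \<open>w\<close> of the word, one layer throws the coefficients at
  \<open>(j mod n) # w\<close> held by the states \<open>j div n\<close> into the next states,
  starting from empty buckets. Different layers read disjoint parts of \<open>L\<close>, so each
  layer adds \<open>1 / K\<close> by the union bound. The table may be longer than needed since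
  \<open>w\<close> may end before the last layer.\<close>

lemma (in abelian_group) prob_pushes_zero:
  assumes "0 < K" "v < K" "G' v w \<noteq> \<zero>" "set w \<subseteq> {..<n}" "\<And>v u. G' v u \<in> carrier G" "length w * (K * n) \<le> J"
  shows "measure_pmf.prob (replicate_pmf J (pmf_of_set {..<K}))
    {L. \<forall>v<K. pushes G K n (length w) L G' v [] = \<zero>} \<le> length w / K"
  using assms(2-)
proof (induction w arbitrary: v G' J)
  case Nil
  then show ?case by (auto simp: measure_pmf.prob_eq_0 AE_measure_pmf_iff)
next
  case (Cons i w)
  let ?U = "pmf_of_set {..<K}"
  define J' where "J' = J - K * n"
  have J: "J = K * n + J'" "length w * (K * n) \<le> J'"
    using Cons.prems(5) by (auto simp: J'_def)
  have i: "i < n" using Cons.prems by simp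
  have push_closed: "push G K n L G' c u \<in> carrier G" for L c u
    unfolding push_def by (rule finsum_closed) (use Cons.prems in auto)
  \<comment> \<open>The bad event of the first layer: no state carries a nonzero coefficient at the
    rest \<open>w\<close> any more.\<close>
  let ?B = "{L. \<forall>c<K. push G K n L G' c w = \<zero>}"
  have "measure_pmf.prob (replicate_pmf J ?U) {L. \<forall>v<K. pushes G K n (length (i # w)) L G' v [] = \<zero>}
     \<le> measure_pmf.prob (replicate_pmf (K * n) ?U) ?B + length w / K"
    unfolding J replicate_pmf_distrib
  proof (rule prob_bind_le)
    fix xs assume xs: "xs \<in> set_pmf (replicate_pmf (K * n) ?U)" "xs \<notin> ?B"
    then obtain c where c: "c < K" "push G K n xs G' c w \<noteq> \<zero>" by blast
    have len: "length xs = K * n" using xs by (auto simp: set_replicate_pmf)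
    have "push G K n (xs @ ys) G' = push G K n xs G'" for ys
      unfolding push_def fun_eq_iff using len
      by (auto intro!: arg_cong[where f = "finsum G _"] simp: nth_append)
    then have "measure_pmf.prob (bind_pmf (replicate_pmf J' ?U) (\<lambda>ys. return_pmf (xs @ ys)))
         {L. \<forall>v<K. pushes G K n (length (i # w)) L G' v [] = \<zero>} =
       measure_pmf.prob (replicate_pmf J' ?U) {L. \<forall>v<K. pushes G K n (length w) L (push G K n xs G') v [] = \<zero>}"
      unfolding map_pmf_def[symmetric] measure_map_pmf by (simp add: vimage_def len)
    also have "\<dots> \<le> length w / K"
      by (rule Cons.IH[where v = c and G' = "push G K n xs G'"]) (use c Cons.prems push_closed J in auto)
    finally show "measure_pmf.prob (bind_pmf (replicate_pmf J' ?U) (\<lambda>ys. return_pmf (xs @ ys)))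
         {L. \<forall>v<K. pushes G K n (length (i # w)) L G' v [] = \<zero>} \<le> length w / K" .
  qed simp
  also have "measure_pmf.prob (replicate_pmf (K * n) ?U) ?B \<le> 1 / K"
  proof -
    have "v * n + i < K * n"
      using i Cons.prems(1) by (metis mult_Suc add.commute add_less_cancel_left less_le_trans mult_le_mono1 Suc_leI)
    moreover have "(v * n + i) div n = v" "(v * n + i) mod n = i" using i by auto
    ultimately have "measure_pmf.prob (replicate_pmf (K * n) ?U)
      {L. \<forall>c<K. \<zero> \<oplus> (\<Oplus>j\<in>{j. j < K * n \<and> L ! j = c}. G' (j div n) ((j mod n) # w)) = \<zero>} \<le> 1 / K"
      by (intro prob_bucket_sums_zero[where ?j0.0 = "v * n + i"]) (use Cons.prems \<open>0 < K\<close> in auto)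
    then show ?thesis using Cons.prems by (simp add: push_def)
  qed
  finally show ?case by (simp add: add_divide_distrib)
qed

section \<open>Evaluation in a layered automaton\<close>

locale layered_automaton =
  fixes n d K :: nat and L :: "nat list"
  assumes K_pos: "0 < K" and length_L: "length L = (d + 1) * K * n"
    and L_less: "\<And>j. j < (d + 1) * K * n \<Longrightarrow> L ! j < K"
begin

definition N :: nat where "N = (d + 1) * K"

text \<open>Layer \<open>t\<close> consists of the states \<open>t * K, ..., t * K + K - 1\<close>; transitions out of the last layer
  and all states from \<open>N\<close> on are dead.\<close>

definition delta :: "nat \<Rightarrow> nat \<Rightarrow> nat" where
  "delta p i = (if p < N then (p div K + 1) * K + L ! (p * n + i) else N)"

definition walk :: "nat \<Rightarrow> nat list \<Rightarrow> nat" where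
  "walk = foldl delta"

definition words :: "nat \<Rightarrow> nat \<Rightarrow> nat list set" where
  "words p q = {w. set w \<subseteq> {..<n} \<and> walk p w = q}"

lemma walk_Nil [simp]: "walk p [] = p" and walk_Cons [simp]: "walk p (i # w) = walk (delta p i) w"
  and walk_append: "walk p (u @ v) = walk (walk p u) v"
  by (simp_all add: walk_def)

lemma L_nth_less:
  assumes "p < N" "i < n"
  shows "L ! (p * n + i) < K"
proof (rule L_less)
  have "p * n + i < p * n + n" using assms by simp
  also have "\<dots> = Suc p * n" by simp
  also have "\<dots> \<le> N * n" using assms by (intro mult_le_mono1) simp
  finally show "p * n + i < (d + 1) * K * n" by (simp add: N_def)
qed

lemma delta_div:
  assumes "p < N" "i < n"
  shows "delta p i div K = p div K + 1"
  using assms K_pos L_nth_less[OF assms] div_mult_self1[of K "L ! (p * n + i)" "p div K + 1"]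
  by (simp add: delta_def add.commute)

lemma N_le_walk: "N \<le> p \<Longrightarrow> N \<le> walk p w"
  by (induction w arbitrary: p) (auto simp: delta_def)

text \<open>Dead states stay dead, so a walk that ends below \<open>N\<close> has never left the
  layers, and every letter climbs exactly one of them.\<close>

lemma walk_div:
  assumes "set w \<subseteq> {..<n}" "walk p w < N"
  shows "p < N \<and> walk p w div K = p div K + length w"
  using assms
proof (induction w arbitrary: p)
  case (Cons i w)
  then have "p < N" using N_le_walk[of p "i # w"] by force
  then show ?case using Cons.IH[of "delta p i"] Cons.prems by (simp add: delta_div)
qed simp

text \<open>A live walk climbs one layer per letter, and the highest layer is \<open>d\<close>. This
  also makes the sets of words finite, so entries are honest finite sums even for coefficient
  functions of infinite support.\<close>

lemma length_words:
  assumes "w \<in> words p q" "q < N"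
  shows "length w \<le> d"
proof -
  have "length w \<le> q div K" using assms walk_div[of w p] by (auto simp: words_def)
  also have "\<dots> < d + 1" using assms K_pos by (simp add: N_def less_mult_imp_div_less)
  finally show ?thesis by simp
qed

lemma finite_words: "q < N \<Longrightarrow> finite (words p q)"
  by (rule finite_subset[OF _ finite_lists_length_le[of "{..<n}" d]])
    (use length_words in \<open>auto simp: words_def\<close>)

end

section \<open>Values at the transition matrices as sums over words\<close>

locale ring_automaton = layered_automaton + cring R for R (structure)
begin

text \<open>\<open>ev f\<close> is the value of \<open>f\<close> at the transition matrices of the letters.\<close>

definition ev :: "(nat list \<Rightarrow> 'a) \<Rightarrow> nat \<Rightarrow> nat \<Rightarrow> 'a" where
  "ev f p q = (\<Oplus>w\<in>words p q. f w)"

lemma ev_closed: "(\<And>w. f w \<in> carrier R) \<Longrightarrow> ev f p q \<in> carrier R"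
  unfolding ev_def by (rule finsum_closed) auto

text \<open>Serves both kinds of leaves of a circuit: \<open>u = [i]\<close> gives the transition
  matrix of a letter, \<open>u = []\<close> a scalar matrix.\<close>

lemma ev_indicator:
  assumes "q < N" "a \<in> carrier R" "set u \<subseteq> {..<n}"
  shows "ev (\<lambda>w. if w = u then a else \<zero>) p q = (if walk p u = q then a else \<zero>)"
proof (cases "walk p u = q")
  case True
  then show ?thesis unfolding ev_def
    using assms add.finprod_singleton_swap[of u "words p q" "\<lambda>_. a"]
    by (auto simp: words_def finite_words[unfolded words_def])
next
  case False
  then show ?thesis unfolding ev_def by (auto intro!: add.finprod_one_eqI simp: words_def)
qed

lemma ev_add:
  assumes "\<And>w. f w \<in> carrier R" "\<And>w. g w \<in> carrier R"
  shows "ev (\<lambda>w. f w \<oplus> g w) p q = ev f p q \<oplus> ev g p q"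
  unfolding ev_def by (rule finsum_addf) (use assms in auto)

text \<open>Cutting a word from \<open>p\<close> to \<open>q\<close> after \<open>i\<close> letters
  amounts to choosing the state \<open>s\<close> reached there, a word from \<open>p\<close> to
  \<open>s\<close> and a word from \<open>s\<close> to \<open>q\<close>. This bijection turns
  convolution into the matrix product. The state \<open>s\<close> lies below \<open>N\<close>
  because a dead state cannot lead to \<open>q\<close>.\<close>

lemma ev_mult:
  assumes "\<And>w. f w \<in> carrier R" "\<And>w. g w \<in> carrier R" "q < N"
  shows "ev (\<lambda>w. \<Oplus>i\<in>{..length w}. f (take i w) \<otimes> g (drop i w)) p q = (\<Oplus>s\<in>{..<N}. ev f p s \<otimes> ev g s q)"
proof -
  let ?A = "Sigma (words p q) (\<lambda>w. {..length w})"
  let ?B = "Sigma {..<N} (\<lambda>s. words p s \<times> words s q)"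
  have bij: "bij_betw (\<lambda>(w, i). (walk p (take i w), take i w, drop i w)) ?A ?B"
  proof (rule bij_betw_byWitness[where f' = "\<lambda>(s, u, v). (u @ v, length u)"])
    have "walk p (take i w) < N" if "set w \<subseteq> {..<n}" "walk p w = q" for w i
    proof (rule ccontr)
      assume "\<not> walk p (take i w) < N"
      then have "N \<le> walk p (take i w @ drop i w)" unfolding walk_append by (rule N_le_walk[OF leI])
      then show False using that assms by simp
    qed
    moreover have "walk (walk p (take i w)) (drop i w) = walk p w" for w i
      by (simp flip: walk_append)
    ultimately show "(\<lambda>(w, i). (walk p (take i w), take i w, drop i w)) ` ?A \<subseteq> ?B"
      by (auto simp: words_def dest: in_set_takeD in_set_dropD)
  qed (auto simp: words_def walk_append)
  have "ev (\<lambda>w. \<Oplus>i\<in>{..length w}. f (take i w) \<otimes> g (drop i w)) p q =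
      (\<Oplus>w\<in>words p q. \<Oplus>i\<in>{..length w}. (\<lambda>(w, i). f (take i w) \<otimes> g (drop i w)) (w, i))"
    by (simp add: ev_def)
  also have "\<dots> = (\<Oplus>x\<in>?A. (\<lambda>(w, i). f (take i w) \<otimes> g (drop i w)) x)"
    by (rule finsum_Sigma) (use assms finite_words in auto)
  also have "\<dots> = (\<Oplus>x\<in>?B. (\<lambda>(s, u, v). f u \<otimes> g v) x)"
    by (rule finsum_bij_betw[OF bij]) (use assms in auto)
  also have "\<dots> = (\<Oplus>s\<in>{..<N}. \<Oplus>x\<in>words p s \<times> words s q. (\<lambda>(s, u, v). f u \<otimes> g v) (s, x))"
    by (rule finsum_Sigma[symmetric]) (use assms finite_words in auto)
  also have "\<dots> = (\<Oplus>s\<in>{..<N}. ev f p s \<otimes> ev g s q)"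
  proof (rule finsum_cong')
    fix s assume s: "s \<in> {..<N}"
    have "(\<Oplus>x\<in>words p s \<times> words s q. (\<lambda>(s, u, v). f u \<otimes> g v) (s, x)) =
       (\<Oplus>u\<in>words p s. \<Oplus>v\<in>words s q. (\<lambda>(u, v). f u \<otimes> g v) (u, v))"
      by (subst finsum_Sigma) (use assms s finite_words in auto)
    also have "\<dots> = (\<Oplus>u\<in>words p s. f u \<otimes> ev g s q)"
      unfolding ev_def using assms finite_words[OF assms(3)]
      by (intro finsum_cong') (auto simp: finsum_rdistr intro!: m_closed finsum_closed)
    also have "\<dots> = ev f p s \<otimes> ev g s q"
      unfolding ev_def[of f] by (rule finsum_ldistr[symmetric]) (use assms s finite_words ev_closed in auto)
    finally show "(\<Oplus>x\<in>words p s \<times> words s q. (\<lambda>(s, u, v). f u \<otimes> g v) (s, x)) = ev f p s \<otimes> ev g s q" .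
  qed (use assms ev_closed in auto)
  finally show ?thesis .
qed

text \<open>A word leading to layer \<open>t + 1\<close> is in a unique way a word leading to some
  state \<open>v\<close> of layer \<open>t\<close> followed by one letter \<open>i\<close>, and the
  pair is numbered by the table index \<open>j = v * n + i\<close>. The assumption on
  \<open>G\<close> says that it collects the coefficients of \<open>w @ u\<close> over all prefixes
  \<open>w\<close> arriving at a state of layer \<open>t\<close>.\<close>

lemma push_words:
  assumes f: "\<And>w. f w \<in> carrier R" and t: "t < d" "c < K"
    and G: "\<And>c u. c < K \<Longrightarrow> G c u = (\<Oplus>w\<in>words 0 (t * K + c). f (w @ u))"
  shows "push R K n (drop (t * (K * n)) L) G c u = (\<Oplus>w\<in>words 0 (Suc t * K + c). f (w @ u))"
proof -
  let ?J = "{j. j < K * n \<and> drop (t * (K * n)) L ! j = c}"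
  let ?S = "Sigma ?J (\<lambda>j. words 0 (t * K + j div n))"
  have lt: "t * K + v < N" if "v < K" for v
  proof -
    have "t * K + v < t * K + K" using that by simp
    also have "\<dots> = (t + 1) * K" by simp
    also have "\<dots> \<le> N" unfolding N_def using t by (intro mult_le_mono1) simp
    finally show ?thesis .
  qed
  have lt': "Suc t * K + v < N" if "v < K" for v
  proof -
    have "Suc t * K + v < Suc t * K + K" using that by simp
    also have "\<dots> = (t + 2) * K" by simp
    also have "\<dots> \<le> N" unfolding N_def using t by (intro mult_le_mono1) simp
    finally show ?thesis .
  qed
  have div: "j div n < K" "0 < n" "j mod n < n" if "j < K * n" for j
    using that by (cases "n = 0"; simp add: less_mult_imp_div_less)+
  \<comment> \<open>Layer \<open>t\<close> owns the block of the table from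
    \<open>t * (K * n)\<close> on; this matches the absolute index that \<open>delta\<close> uses
    for state \<open>t * K + v\<close>.\<close>
  have L: "drop (t * (K * n)) L ! j = L ! ((t * K + j div n) * n + j mod n)" if "j < K * n" for j
  proof -
    have "t * (K * n) + j < (d + 1) * K * n"
    proof -
      have "t * (K * n) + j < (t + 1) * (K * n)" using that by simp
      also have "\<dots> \<le> (d + 1) * (K * n)" using t by (intro mult_le_mono1) simp
      finally show ?thesis by (simp only: mult.assoc)
    qed
    moreover have "t * (K * n) + j = (t * K + j div n) * n + j mod n"
      by (simp add: algebra_simps)
    moreover have "t * (K * n) \<le> length L"
      unfolding length_L using calculation(1) by linarith
    ultimately show ?thesis by (metis nth_drop)
  qed
  have step: "delta (t * K + j div n) (j mod n) = Suc t * K + drop (t * (K * n)) L ! j" if "j < K * n" for j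
    using div[OF that] lt[of "j div n"] L[OF that] by (simp add: delta_def)
  have bij: "bij_betw (\<lambda>(j, w). w @ [j mod n]) ?S (words 0 (Suc t * K + c))"
  \<comment> \<open>The inverse removes the last letter; the state reached before it, reduced modulo
    \<open>K\<close>, is its position within layer \<open>t\<close>.\<close>
  proof (rule bij_betw_byWitness[where f' = "\<lambda>w. ((walk 0 (butlast w) mod K) * n + last w, butlast w)"])
    show "\<forall>a\<in>?S. (\<lambda>w. ((walk 0 (butlast w) mod K) * n + last w, butlast w)) ((\<lambda>(j, w). w @ [j mod n]) a) = a"
      using div by (auto simp: words_def)
    show "(\<lambda>(j, w). w @ [j mod n]) ` ?S \<subseteq> words 0 (Suc t * K + c)"
      using div step by (auto simp: words_def walk_append)
    have *: "w \<noteq> [] \<and> last w < n \<and> walk 0 (butlast w) div K = t \<and>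
       (walk 0 (butlast w) mod K) * n + last w < K * n \<and> butlast w \<in> words 0 (walk 0 (butlast w)) \<and>
       delta (walk 0 (butlast w)) (last w) = Suc t * K + c"
      if w: "w \<in> words 0 (Suc t * K + c)" for w
    proof -
      have wl: "length w = Suc t" using w walk_div[of w 0] lt'[OF t(2)] t div_mult_self1[of K c "Suc t"]
        by (simp add: words_def add.commute)
      then obtain v i where vi: "w = v @ [i]" by (cases w rule: rev_cases) auto
      have i: "i < n" "set v \<subseteq> {..<n}" using w vi by (auto simp: words_def)
      have "N \<le> delta (walk 0 v) i" if "\<not> walk 0 v < N" using that by (simp add: delta_def)
      then have vN: "walk 0 v < N" using w lt'[OF t(2)] vi by (force simp: words_def walk_append)
      then have "walk 0 v div K = t" using walk_div[OF i(2) vN] wl vi by simp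
      moreover have "(walk 0 v mod K) * n + i < K * n"
      proof -
        have "(walk 0 v mod K) * n + i < Suc (walk 0 v mod K) * n" using i by simp
        also have "\<dots> \<le> K * n" using K_pos by (intro mult_le_mono1) (simp add: Suc_leI)
        finally show ?thesis .
      qed
      ultimately show ?thesis using i w vi by (auto simp: words_def walk_append)
    qed
    have tm: "t * K + walk 0 (butlast w) mod K = walk 0 (butlast w)" if "walk 0 (butlast w) div K = t" for w
      using that div_mult_mod_eq[of "walk 0 (butlast w)" K] by simp
    show "\<forall>w\<in>words 0 (Suc t * K + c). (\<lambda>(j, w). w @ [j mod n]) ((walk 0 (butlast w) mod K) * n + last w, butlast w) = w"
      using * by auto
    show "(\<lambda>w. ((walk 0 (butlast w) mod K) * n + last w, butlast w)) ` words 0 (Suc t * K + c) \<subseteq> ?S"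
    proof clarify
      fix w assume w: "w \<in> words 0 (Suc t * K + c)"
      let ?j = "(walk 0 (butlast w) mod K) * n + last w"
      have j: "?j < K * n" "?j div n = walk 0 (butlast w) mod K" "?j mod n = last w" using *[OF w] by auto
      have "Suc t * K + drop (t * (K * n)) L ! ?j = Suc t * K + c"
        using step[OF j(1)] *[OF w] tm[of w] j by simp
      then show "?j \<in> ?J \<and> butlast w \<in> words 0 (t * K + ?j div n)"
        using *[OF w] tm[of w] j by simp
    qed
  qed
  have "push R K n (drop (t * (K * n)) L) G c u =
    (\<Oplus>j\<in>?J. \<Oplus>w\<in>words 0 (t * K + j div n). (\<lambda>(j, w). f (w @ j mod n # u)) (j, w))"
    unfolding push_def by (rule finsum_cong') (use f div G in \<open>auto intro!: finsum_closed\<close>)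
  also have "\<dots> = (\<Oplus>x\<in>?S. (\<lambda>(j, w). f (w @ j mod n # u)) x)"
    by (rule finsum_Sigma) (use f div lt finite_words in auto)
  also have "\<dots> = (\<Oplus>w\<in>words 0 (Suc t * K + c). f (w @ u))"
    by (rule finsum_bij_betw[OF bij]) (use f in auto)
  finally show ?thesis .
qed

lemma pushes_words:
  assumes "\<And>w. f w \<in> carrier R" "t + k \<le> d" "c < K"
    and "\<And>c u. c < K \<Longrightarrow> G c u = (\<Oplus>w\<in>words 0 (t * K + c). f (w @ u))"
  shows "pushes R K n k (drop (t * (K * n)) L) G c u = (\<Oplus>w\<in>words 0 ((t + k) * K + c). f (w @ u))"
  using assms(2-)
proof (induction k arbitrary: t G)
  case 0
  then show ?case by simp
next
  case (Suc k)
  have "pushes R K n k (drop (Suc t * (K * n)) L) (push R K n (drop (t * (K * n)) L) G) c u =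
      (\<Oplus>w\<in>words 0 ((Suc t + k) * K + c). f (w @ u))"
  proof (rule Suc.IH)
    show "push R K n (drop (t * (K * n)) L) G c u = (\<Oplus>w\<in>words 0 (Suc t * K + c). f (w @ u))"
      if "c < K" for c u
      by (rule push_words) (use assms(1) Suc.prems that in auto)
  qed (use Suc.prems in auto)
  then show ?case by simp
qed

text \<open>The link between the matrix that the program computes and the random process of the
  error estimate. At the start all of \<open>f\<close> waits at state 0, since a nonempty word never
  ends in layer 0.\<close>

lemma ev_pushes:
  assumes "\<And>w. f w \<in> carrier R" "k \<le> d" "v < K"
  shows "ev f 0 (k * K + v) = pushes R K n k L (\<lambda>v u. if v = 0 then f u else \<zero>) v []"
proof -
  have w0: "words 0 c = (if c = 0 then {[]} else {})" if c: "c < K" for c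
  proof -
    have "w = []" if "set w \<subseteq> {..<n}" "walk 0 w = c" for w
      using walk_div[OF that(1), of 0] that(2) c by (simp add: N_def)
    then show ?thesis by (cases "c = 0") (force simp: words_def)+
  qed
  have "pushes R K n k (drop (0 * (K * n)) L) (\<lambda>v u. if v = 0 then f u else \<zero>) v [] =
      (\<Oplus>w\<in>words 0 ((0 + k) * K + v). f (w @ []))"
    by (rule pushes_words) (use assms w0 in auto)
  then show ?thesis by (simp add: ev_def)
qed

end

section \<open>Polynomials computed at the gates, and the error bound for one row\<close>

lemma gate_poly_cong:
  "wf_gate R n p g \<Longrightarrow> (\<And>j. j < p \<Longrightarrow> fs ! j = fs' ! j) \<Longrightarrow> gate_poly R n fs g = gate_poly R n fs' g"
  by (cases g) auto

definition gate_polys :: "('a, 'b) ring_scheme \<Rightarrow> nat \<Rightarrow> 'a circuit \<Rightarrow> (nat list \<Rightarrow> 'a) list" where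
  "gate_polys R n C = foldl (\<lambda>fs g. fs @ [gate_poly R n fs g]) [] C"

lemma gate_polys_snoc: "gate_polys R n (C @ [g]) = gate_polys R n C @ [gate_poly R n (gate_polys R n C) g]"
  by (simp add: gate_polys_def)

lemma length_gate_polys [simp]: "length (gate_polys R n C) = length C"
proof (induction C rule: rev_induct)
  case (snoc g C)
  then show ?case by (simp add: gate_polys_snoc)
qed (simp add: gate_polys_def)

text \<open>A well-formed gate refers to earlier positions only, and later gates only append to the
  list; so the recursion of the fold can be read off the finished list.\<close>

lemma gate_polys_nth:
  assumes "\<And>p. p < length C \<Longrightarrow> wf_gate R n p (C ! p)" "p < length C"
  shows "gate_polys R n C ! p = gate_poly R n (gate_polys R n C) (C ! p)"
  using assms
proof (induction C arbitrary: p rule: rev_induct)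
  case (snoc g C)
  have wf: "wf_gate R n q (C ! q)" if "q < length C" for q
    using snoc.prems(1)[of q] that by (simp add: nth_append)
  show ?case
  proof (cases "p < length C")
    case True
    then show ?thesis
      using snoc.IH[OF wf True] gate_poly_cong[OF wf[OF True], of "gate_polys R n C" "gate_polys R n (C @ [g])"]
      by (simp add: gate_polys_snoc nth_append)
  next
    case False
    then have p: "p = length C" using snoc.prems by simp
    have "wf_gate R n p g" using snoc.prems(1)[of p] p by simp
    then show ?thesis
      using gate_poly_cong[of R n p g "gate_polys R n C" "gate_polys R n (C @ [g])"] p
      by (simp add: gate_polys_snoc nth_append)
  qed
qed simp

lemma circuit_poly_eq_nth:
  "C \<noteq> [] \<Longrightarrow> circuit_poly R n C = gate_polys R n C ! (length C - 1)"
  unfolding circuit_poly_def gate_polys_def[symmetric]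
  using length_gate_polys[of R n C] by (metis last_conv_nth length_0_conv)

context cring begin

text \<open>A nonzero coefficient of the product at \<open>w\<close> forces a cut of
  \<open>w\<close> into two words at which the factors are nonzero, so the support lies in the
  concatenations of the two finite supports.\<close>

lemma free_algebra_mult_closed:
  assumes f: "f \<in> carrier (free_algebra R n)" and g: "g \<in> carrier (free_algebra R n)"
  shows "f \<otimes>\<^bsub>free_algebra R n\<^esub> g \<in> carrier (free_algebra R n)"
proof -
  let ?h = "\<lambda>w. \<Oplus>i\<in>{..length w}. f (take i w) \<otimes> g (drop i w)"
  have cl: "f w \<in> carrier R" "g w \<in> carrier R" for w using f g by (auto simp: free_algebra_def)
  have split: "\<exists>u v. w = u @ v \<and> f u \<noteq> \<zero> \<and> g v \<noteq> \<zero>" if "?h w \<noteq> \<zero>" for w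
  proof -
    have "\<exists>i. f (take i w) \<otimes> g (drop i w) \<noteq> \<zero>"
      using that by (rule contrapos_np) (simp add: add.finprod_one_eqI)
    then obtain i where "f (take i w) \<otimes> g (drop i w) \<noteq> \<zero>" by blast
    then have "f (take i w) \<noteq> \<zero>" "g (drop i w) \<noteq> \<zero>" using cl by force+
    then show ?thesis by (metis append_take_drop_id)
  qed
  have "{w. ?h w \<noteq> \<zero>} \<subseteq> (\<lambda>(u, v). u @ v) ` ({w. f w \<noteq> \<zero>} \<times> {w. g w \<noteq> \<zero>})"
    using split by force
  moreover have "finite ({w. f w \<noteq> \<zero>} \<times> {w. g w \<noteq> \<zero>})" using f g by (simp add: free_algebra_def)
  ultimately have "finite {w. ?h w \<noteq> \<zero>}" by (rule finite_surj[rotated])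
  moreover have "set w \<subseteq> {..<n}" if "?h w \<noteq> \<zero>" for w
    using split[OF that] f g by (auto simp: free_algebra_def) blast+
  moreover have "?h w \<in> carrier R" for w using cl by (intro finsum_closed) auto
  ultimately show ?thesis by (simp add: free_algebra_def)
qed

lemma free_algebra_add_closed:
  assumes f: "f \<in> carrier (free_algebra R n)" and g: "g \<in> carrier (free_algebra R n)"
  shows "f \<oplus>\<^bsub>free_algebra R n\<^esub> g \<in> carrier (free_algebra R n)"
proof -
  have fg: "f w \<noteq> \<zero> \<or> g w \<noteq> \<zero>" if "f w \<oplus> g w \<noteq> \<zero>" for w using that by auto
  have "finite {w. f w \<oplus> g w \<noteq> \<zero>}"
    by (rule finite_subset[of _ "{w. f w \<noteq> \<zero>} \<union> {w. g w \<noteq> \<zero>}"]) (use fg f g in \<open>auto simp: free_algebra_def\<close>)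
  moreover have "set w \<subseteq> {..<n}" if "f w \<oplus> g w \<noteq> \<zero>" for w
    using fg[OF that] f g by (auto simp: free_algebra_def)
  ultimately show ?thesis using f g by (auto simp: free_algebra_def)
qed

lemma nc_var_closed: "i < n \<Longrightarrow> nc_var R i \<in> carrier (free_algebra R n)"
  by (auto simp: free_algebra_def nc_var_def)

lemma nc_const_closed: "a \<in> carrier R \<Longrightarrow> nc_const R a \<in> carrier (free_algebra R n)"
  by (auto simp: free_algebra_def nc_const_def)

lemma gate_polys_closed:
  assumes "\<And>p. p < length C \<Longrightarrow> wf_gate R n p (C ! p)" "p < length C"
  shows "gate_polys R n C ! p \<in> carrier (free_algebra R n)"
  using assms(2)
proof (induction p rule: less_induct)
  case (less p)
  have *: "gate_polys R n C ! p = gate_poly R n (gate_polys R n C) (C ! p)"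
    by (rule gate_polys_nth) (use assms less in auto)
  show ?case unfolding * using assms(1)[OF less.prems] less
    by (cases "C ! p") (auto intro!: nc_var_closed nc_const_closed free_algebra_add_closed free_algebra_mult_closed)
qed

text \<open>One word \<open>w\<close> with a nonzero coefficient is enough: if the whole row
  vanishes, so does its part in layer \<open>length w\<close>, which consists of the values left at
  the empty word after \<open>length w\<close> pushes.\<close>

lemma prob_row_zero_le:
  assumes f: "f \<in> carrier (free_algebra R n)" "f \<noteq> \<zero>\<^bsub>free_algebra R n\<^esub>" "nc_degree R f \<le> d"
    and K: "0 < K"
  shows "measure_pmf.prob (replicate_pmf ((d + 1) * K * n) (pmf_of_set {..<K}))
    {L. \<forall>q<(d + 1) * K. ring_automaton.ev n d K L R f 0 q = \<zero>} \<le> d / K"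
proof -
  have cl: "f w \<in> carrier R" for w using f by (auto simp: free_algebra_def)
  have fin: "finite {w. f w \<noteq> \<zero>}" using f by (auto simp: free_algebra_def)
  obtain w where w: "f w \<noteq> \<zero>" using f(2) by (auto simp: free_algebra_def fun_eq_iff)
  have wn: "set w \<subseteq> {..<n}" using f w by (auto simp: free_algebra_def)
  have "length w \<le> nc_degree R f" unfolding nc_degree_def using fin w by (intro Max_ge) auto
  then have wd: "length w \<le> d" using f by simp
  let ?G = "\<lambda>v u. if v = (0::nat) then f u else \<zero>"
  have "measure_pmf.prob (replicate_pmf ((d + 1) * K * n) (pmf_of_set {..<K}))
      {L. \<forall>q<(d + 1) * K. ring_automaton.ev n d K L R f 0 q = \<zero>}
    \<le> measure_pmf.prob (replicate_pmf ((d + 1) * K * n) (pmf_of_set {..<K}))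
      {L. \<forall>v<K. pushes R K n (length w) L ?G v [] = \<zero>}"
  \<comment> \<open>Only tables in the support have the length and the range that make them an
    automaton, so the inclusion of the events is shown there only.\<close>
  proof (rule measure_pmf.finite_measure_mono_AE, unfold AE_measure_pmf_iff, intro ballI impI CollectI allI)
    fix L v assume L: "L \<in> set_pmf (replicate_pmf ((d + 1) * K * n) (pmf_of_set {..<K}))"
      and z: "L \<in> {L. \<forall>q<(d + 1) * K. ring_automaton.ev n d K L R f 0 q = \<zero>}" and v: "v < K"
    interpret ring_automaton n d K L R
      by unfold_locales (use K L in \<open>auto simp: set_replicate_pmf lessThan_empty_iff subset_iff dest!: nth_mem\<close>)
    have "length w * K + v < Suc (length w) * K" using v by simp
    also have "\<dots> \<le> (d + 1) * K" using wd by (intro mult_le_mono1) simp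
    finally have "ev f 0 (length w * K + v) = \<zero>" using z by simp
    then show "pushes R K n (length w) L ?G v [] = \<zero>" using ev_pushes[OF cl wd v] by simp
  qed simp
  also have "\<dots> \<le> length w / K"
  proof (rule prob_pushes_zero[where v = 0])
    have "length w * (K * n) \<le> (d + 1) * (K * n)" using wd by (intro mult_le_mono1) simp
    then show "length w * (K * n) \<le> (d + 1) * K * n" by (simp only: mult.assoc)
  qed (use K w wn cl in auto)
  also have "\<dots> \<le> d / K" using wd by (simp add: divide_right_mono)
  finally show ?thesis .
qed

end

section \<open>Weakest preconditions with time\<close>

definition agree :: "(nat \<Rightarrow> nat) \<Rightarrow> (nat \<Rightarrow> nat) \<Rightarrow> bool" where
  "agree r r' \<longleftrightarrow> (\<forall>x<100. r x = r' x)"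

definition assign :: "nat \<Rightarrow> aexp \<Rightarrow> com" where
  "assign x e = Seq (compile e 100) (Seq (SetConst x 0) (AddReg x x 100))"

definition put :: "aexp \<Rightarrow> nat \<Rightarrow> com" where
  "put e x = Seq (compile e 100) (Store 100 x)"

locale timed =
  fixes m :: nat and R :: "bits ring" and B :: nat
begin

text \<open>An expression of at most 16 nodes takes \<open>16 * (5 * B + 30) = 80 * B + 480\<close>
  steps; the remainder, rounded up, pays for storing the result and for control flow.\<close>

definition time_unit :: nat where "time_unit = 100 * B + 700"

text \<open>The registers from 100 on are scratch space of compiled expressions, hence invisible to assertions.
  Time is counted in units, each long enough for one assignment and the surrounding control flow.\<close>

definition wp :: "com \<Rightarrow> nat \<Rightarrow> (store \<Rightarrow> bool) \<Rightarrow> store \<Rightarrow> bool" where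
  "wp c k Q = (\<lambda>(r, h, bs). \<forall>r'. agree r' r \<longrightarrow>
     reaches m R c (k * time_unit) (\<lambda>(r', h', bs'). \<exists>r. agree r' r \<and> Q (r, h', bs')) (r', h, bs))"

lemma wpI:
  "(\<And>r'. agree r' r \<Longrightarrow> reaches m R c (k * time_unit) (\<lambda>(r', h', bs'). \<exists>r. agree r' r \<and> Q (r, h', bs')) (r', h, bs))
    \<Longrightarrow> wp c k Q (r, h, bs)"
  unfolding wp_def by blast

lemma wpD:
  "wp c k Q (r, h, bs) \<Longrightarrow> agree r' r \<Longrightarrow>
    reaches m R c (k * time_unit) (\<lambda>(r', h', bs'). \<exists>r. agree r' r \<and> Q (r, h', bs')) (r', h, bs)"
  unfolding wp_def by blast

lemma wp_mono:
  assumes "wp c k Q s" "k \<le> k'" "\<And>r h bs. Q (r, h, bs) \<Longrightarrow> Q' (r, h, bs)"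
  shows "wp c k' Q' s"
proof -
  obtain r h bs where s: "s = (r, h, bs)" by (cases s)
  show ?thesis unfolding s
    by (rule wpI, rule reaches_mono[OF wpD[OF assms(1)[unfolded s]]]) (use assms in auto)
qed

lemma wp_Skip: "Q s \<Longrightarrow> wp Skip k Q s"
  by (cases s) (auto intro!: wpI reaches_Skip)

text \<open>The strict inequality spends a whole unit on the single step of sequencing, which keeps
  all times integral in units.\<close>

lemma wp_Seq:
  assumes "wp c1 k1 (wp c2 k2 Q) s" "k1 + k2 < k"
  shows "wp (Seq c1 c2) k Q s"
proof -
  obtain r h bs where s: "s = (r, h, bs)" by (cases s)
  have "(k1 + k2 + 1) * time_unit \<le> k * time_unit" using assms(2) by (intro mult_le_mono1) simp
  then have t: "k1 * time_unit + k2 * time_unit + 1 \<le> k * time_unit" by (simp add: time_unit_def algebra_simps)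
  show ?thesis unfolding s
    by (rule wpI, rule reaches_Seq[OF _ t], rule reaches_mono[OF wpD[OF assms(1)[unfolded s]]])
      (auto dest: wpD)
qed

lemma wp_IfLess:
  assumes "x < 100" "y < 100" "0 < k"
    and "r x < r y \<Longrightarrow> wp c1 (k - 1) Q (r, h, bs)" "\<not> r x < r y \<Longrightarrow> wp c2 (k - 1) Q (r, h, bs)"
  shows "wp (IfLess x y c1 c2) k Q (r, h, bs)"
proof (rule wpI, rule reaches_IfLess)
  show "(k - 1) * time_unit < k * time_unit" using assms(3) by (simp add: time_unit_def)
qed (use assms in \<open>auto simp: agree_def intro: wpD[unfolded agree_def]\<close>)

lemma wp_WhileLess:
  assumes "x < 100" "y < 100"
    and "\<And>j r h bs. j < k \<Longrightarrow> I j (r, h, bs) \<Longrightarrow> r x < r y \<and> wp c b (I (Suc j)) (r, h, bs)"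
    and "\<And>r h bs. I k (r, h, bs) \<Longrightarrow> \<not> r x < r y \<and> Q (r, h, bs)"
    and "I 0 s" "k * (b + 1) < t"
  shows "wp (WhileLess x y c) t Q s"
proof -
  obtain r h bs where s: "s = (r, h, bs)" by (cases s)
  show ?thesis unfolding s
  proof (rule wpI, rule reaches_WhileLess[where I = "\<lambda>j (r, h, bs). \<exists>r'. agree r r' \<and> I j (r', h, bs)" and j = 0])
    fix r' assume "agree r' r"
    then show "(\<lambda>(r, h, bs). \<exists>r'. agree r r' \<and> I 0 (r', h, bs)) (r', h, bs)" using assms s by auto
  next
    fix j r h bs
    assume j: "j < k" "(\<lambda>(r, h, bs). \<exists>r'. agree r r' \<and> I j (r', h, bs)) (r, h, bs)"
    then obtain r' where r': "agree r r'" "I j (r', h, bs)" by auto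
    with assms(3)[OF j(1) this(2)] assms(1,2)
    show "r x < r y \<and> reaches m R c (b * time_unit) (\<lambda>(r, h, bs). \<exists>r'. agree r r' \<and> I (Suc j) (r', h, bs)) (r, h, bs)"
      by (auto dest: wpD simp: agree_def)
  next
    fix r h bs
    assume "(\<lambda>(r, h, bs). \<exists>r'. agree r r' \<and> I k (r', h, bs)) (r, h, bs)"
    then obtain r' where r': "agree r r'" "I k (r', h, bs)" by auto
    with assms(4)[OF this(2)] assms(1,2)
    show "\<not> r x < r y \<and> (\<lambda>(r', h', bs'). \<exists>r. agree r' r \<and> Q (r, h', bs')) (r, h, bs)"
      by (auto simp: agree_def)
  next
    have "(k * (b + 1) + 1) * time_unit \<le> t * time_unit" using assms(6) by (intro mult_le_mono1) simp
    moreover have "k * (b * time_unit + 2) \<le> k * ((b + 1) * time_unit)" by (intro mult_le_mono2) (simp add: time_unit_def)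
    moreover have "0 < time_unit" by (simp add: time_unit_def)
    ultimately show "(k - 0) * (b * time_unit + 2) < t * time_unit" by (simp add: algebra_simps)
  qed simp
qed

definition small :: "aexp \<Rightarrow> (nat \<Rightarrow> nat) \<Rightarrow> (nat \<Rightarrow> nat) \<Rightarrow> bool" where
  "small e r h \<longleftrightarrow> vars_below 100 e \<and> nodes e \<le> 16 \<and> cheap B e r h"

lemma reaches_compile_small:
  assumes "small e r h" "agree r' r"
    and "\<And>r''. r'' 100 = aval e r h \<Longrightarrow> agree r'' r \<Longrightarrow> Q (r'', h, bs)"
  shows "reaches m R (compile e 100) (80 * B + 480) Q (r', h, bs)"
proof (rule reaches_compile[of _ _ B])
  have "nodes e * (5 * B + 30) \<le> 16 * (5 * B + 30)"
    using assms(1) unfolding small_def by (intro mult_le_mono1) simp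
  then show "nodes e * (5 * B + 30) \<le> 80 * B + 480" by simp
  show "cheap B e r' h" using assms cheap_cong[of 100 e r' r B h] by (simp add: small_def agree_def)
  fix r'' assume "r'' 100 = aval e r' h" "\<forall>x<100. r'' x = r' x"
  then show "Q (r'', h, bs)"
    using assms aval_cong[of 100 e r' r h] by (intro assms(3)) (simp_all add: small_def agree_def)
qed (use assms in \<open>simp add: small_def\<close>)

lemma wp_assign:
  assumes "x < 100" "small e r h" "0 < k" "Q (r(x := aval e r h), h, bs)"
  shows "wp (assign x e) k Q (r, h, bs)"
proof (rule wpI)
  fix r' assume r': "agree r' r"
  have "time_unit \<le> k * time_unit" using assms(3) by simp
  moreover have "80 * B + 480 + 100 + 1 \<le> time_unit" by (simp add: time_unit_def)
  ultimately have t: "80 * B + 480 + 100 + 1 \<le> k * time_unit" by linarith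
  show "reaches m R (assign x e) (k * time_unit) (\<lambda>(r', h', bs'). \<exists>r. agree r' r \<and> Q (r, h', bs')) (r', h, bs)"
    unfolding assign_def
  proof (rule reaches_Seq[OF reaches_compile_small[OF assms(2) r'] t])
    fix r'' assume r'': "r'' 100 = aval e r h" "agree r'' r"
    have "agree (r''(x := aval e r h)) (r(x := aval e r h))" using r'' by (simp add: agree_def)
    then show "reaches m R (Seq (SetConst x 0) (AddReg x x 100)) 100
       (\<lambda>(r', h', bs'). \<exists>r. agree r' r \<and> Q (r, h', bs')) (r'', h, bs)"
      using assms r''
      by (intro reaches_Seq[of _ _ _ 1 _ 1] reaches_atomic[OF dstep.simps(4)] reaches_atomic[OF dstep.simps(5)])
        auto
  qed
qed

lemma wp_assign_Seq:
  assumes "x < 100" "small e r h" "2 < k" "wp c (k - 2) Q (r(x := aval e r h), h, bs)"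
  shows "wp (Seq (assign x e) c) k Q (r, h, bs)"
  by (rule wp_Seq[of _ 1 _ "k - 2"] wp_assign)+ (use assms in auto)

lemma wp_put:
  assumes "x < 100" "small e r h" "0 < k" "Q (r, h(aval e r h := r x), bs)"
  shows "wp (put e x) k Q (r, h, bs)"
proof (rule wpI)
  fix r' assume r': "agree r' r"
  have "time_unit \<le> k * time_unit" using assms(3) by simp
  moreover have "80 * B + 480 + 100 + 1 \<le> time_unit" by (simp add: time_unit_def)
  ultimately have t: "80 * B + 480 + 100 + 1 \<le> k * time_unit" by linarith
  show "reaches m R (put e x) (k * time_unit) (\<lambda>(r', h', bs'). \<exists>r. agree r' r \<and> Q (r, h', bs')) (r', h, bs)"
    unfolding put_def
    by (rule reaches_Seq[OF reaches_compile_small[OF assms(2) r'] t])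
      (rule reaches_atomic, rule dstep.simps, use assms in \<open>auto simp: agree_def\<close>)
qed

lemma wp_put_Seq:
  assumes "x < 100" "small e r h" "2 < k" "wp c (k - 2) Q (r, h(aval e r h := r x), bs)"
  shows "wp (Seq (put e x) c) k Q (r, h, bs)"
  by (rule wp_Seq[of _ 1 _ "k - 2"] wp_put)+ (use assms in auto)

lemma wp_atomic:
  assumes "\<And>r'. agree r' r \<Longrightarrow> \<exists>r''. dstep m R ((c, r', h), bs) = ((Skip, r'', h'), bs') \<and> agree r'' s"
    and "0 < k" "Q (s, h', bs')"
  shows "wp c k Q (r, h, bs)"
proof (rule wpI)
  fix r' assume "agree r' r"
  then obtain r'' where "dstep m R ((c, r', h), bs) = ((Skip, r'', h'), bs')" "agree r'' s"
    using assms(1) by blast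
  then show "reaches m R c (k * time_unit) (\<lambda>(r', h', bs'). \<exists>r. agree r' r \<and> Q (r, h', bs')) (r', h, bs)"
    using assms(2,3) by (intro reaches_atomic) (auto simp: time_unit_def)
qed

lemma wp_Coin_Seq:
  assumes "x < 100" "bs \<noteq> []" "2 < k" "wp c (k - 2) Q (r(x := of_bool (hd bs)), h, tl bs)"
  shows "wp (Seq (Coin x) c) k Q (r, h, bs)"
  by (rule wp_Seq[of _ 1 _ "k - 2"], rule wp_atomic[where s = "r(x := of_bool (hd bs))" and h' = h and bs' = "tl bs"])
    (use assms in \<open>auto simp: agree_def neq_Nil_conv\<close>)

lemma wp_RingAdd:
  assumes "x < 100" "y < 100" "z < 100" "0 < k"
    "Q (r(x := encode_bits (decode_bits m (r y) \<oplus>\<^bsub>R\<^esub> decode_bits m (r z))), h, bs)"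
  shows "wp (RingAdd x y z) k Q (r, h, bs)"
  by (rule wp_atomic[where Q = Q, OF _ assms(4,5)]) (use assms(1-3) in \<open>auto simp: agree_def\<close>)

lemma wp_RingMul_Seq:
  assumes "x < 100" "y < 100" "z < 100" "2 < k"
    "wp c (k - 2) Q (r(x := encode_bits (decode_bits m (r y) \<otimes>\<^bsub>R\<^esub> decode_bits m (r z))), h, bs)"
  shows "wp (Seq (RingMul x y z) c) k Q (r, h, bs)"
  by (rule wp_Seq[of _ 1 _ "k - 2"],
      rule wp_atomic[where s = "r(x := encode_bits (decode_bits m (r y) \<otimes>\<^bsub>R\<^esub> decode_bits m (r z)))"])
    (use assms in \<open>auto simp: agree_def\<close>)

lemma wp_RingAdd_Seq:
  assumes "x < 100" "y < 100" "z < 100" "2 < k"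
    "wp c (k - 2) Q (r(x := encode_bits (decode_bits m (r y) \<oplus>\<^bsub>R\<^esub> decode_bits m (r z))), h, bs)"
  shows "wp (Seq (RingAdd x y z) c) k Q (r, h, bs)"
  by (rule wp_Seq[of _ 1 _ "k - 2"] wp_RingAdd)+ (use assms in auto)

text \<open>The machine compares strictly; two opposite tests with the common branch
  \<open>c2\<close> decide equality.\<close>

lemma wp_If_eq:
  assumes "x < 100" "y < 100" "2 < k"
    and "r x = r y \<Longrightarrow> wp c1 (k - 2) Q (r, h, bs)" "r x \<noteq> r y \<Longrightarrow> wp c2 (k - 2) Q (r, h, bs)"
  shows "wp (IfLess x y c2 (IfLess y x c2 c1)) k Q (r, h, bs)"
  by (intro wp_IfLess wp_mono[OF assms(5)]) (use assms in \<open>auto simp: numeral_2_eq_2\<close>)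

end

section \<open>The program\<close>

abbreviation Mod :: "aexp \<Rightarrow> aexp \<Rightarrow> aexp" where
  "Mod a b \<equiv> Minus a (Times (Div a b) b)"

text \<open>Registers: 1 \<open>n\<close>, 2 \<open>d\<close>, 3 zero, 4 one, 5 number of gates, 6 \<open>K\<close>, 7 \<open>N\<close>, 8 address of the transition
  table, 9 address of the matrices, 10 and 11 bound and counter of the current main loop, 12 and 13 random
  number and its range, 15 column, 16 row, 17 gate, 18 to 20 the input triple of that gate, 21 result, 24
  summation index, 22 and 23 operands.  Entry \<open>(p, q)\<close> of the matrix of gate \<open>g\<close> has offset
  \<open>(g * N + p) * N + q\<close>.\<close>

definition gen_loop :: com where
  "gen_loop = Seq (assign 12 (Plus (Var 12) (Var 12))) (Seq (Coin 14)
     (Seq (assign 12 (Plus (Var 12) (Var 14))) (assign 13 (Plus (Var 13) (Var 13)))))"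

text \<open>The random number is completed to an absolute state: index \<open>e\<close> belongs to a
  state in layer \<open>e div n div K\<close>, and the start of the next layer is added.\<close>

definition gen_body :: com where
  "gen_body = Seq (assign 12 (Num 0)) (Seq (assign 13 (Num 1))
     (Seq (WhileLess 13 6 gen_loop)
     (Seq (assign 14 (Plus (Times (Plus (Div (Div (Var 11) (Var 1)) (Var 6)) (Num 1)) (Var 6)) (Var 12)))
     (Seq (put (Plus (Var 8) (Var 11)) 14) (assign 11 (Plus (Var 11) (Num 1)))))))"

definition var_code :: com where
  "var_code = Seq (assign 22 (Mem (Plus (Var 8) (Plus (Times (Var 16) (Var 1)) (Var 19)))))
     (Seq (assign 21 (Var 3)) (IfLess 22 15 Skip (IfLess 15 22 Skip (assign 21 (Var 4)))))"

definition const_code :: com where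
  "const_code = Seq (assign 21 (Var 3)) (IfLess 15 16 Skip (IfLess 16 15 Skip (assign 21 (Var 19))))"

abbreviation mat_entry :: "nat \<Rightarrow> nat \<Rightarrow> nat \<Rightarrow> aexp" where
  "mat_entry g p q \<equiv> Mem (Plus (Var 9) (Plus (Times (Plus (Times (Var g) (Var 7)) (Var p)) (Var 7)) (Var q)))"

definition add_code :: com where
  "add_code = Seq (assign 22 (mat_entry 19 16 15)) (Seq (assign 23 (mat_entry 20 16 15)) (RingAdd 21 22 23))"

definition mul_loop :: com where
  "mul_loop = Seq (assign 22 (mat_entry 19 16 24)) (Seq (assign 23 (mat_entry 20 24 15))
     (Seq (RingMul 22 22 23) (Seq (RingAdd 21 21 22) (assign 24 (Plus (Var 24) (Num 1))))))"

definition mul_code :: com where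
  "mul_code = Seq (assign 21 (Var 3)) (Seq (assign 24 (Num 0)) (WhileLess 24 7 mul_loop))"

text \<open>A single counter replaces three nested loops; gate, row and column are its digits in
  base \<open>N\<close>. As the gate is the leading digit, the matrices of the operands are complete
  before they are read.\<close>

definition eval_body :: com where
  "eval_body =
     Seq (assign 15 (Mod (Var 11) (Var 7)))
     (Seq (assign 16 (Mod (Div (Var 11) (Var 7)) (Var 7)))
     (Seq (assign 17 (Div (Div (Var 11) (Var 7)) (Var 7)))
     (Seq (assign 18 (Mem (Plus (Num 6) (Times (Var 17) (Num 3)))))
     (Seq (assign 19 (Mem (Plus (Num 7) (Times (Var 17) (Num 3)))))
     (Seq (assign 20 (Mem (Plus (Num 8) (Times (Var 17) (Num 3)))))
     (Seq (assign 25 (Num 1)) (Seq (assign 26 (Num 2)) (Seq (assign 27 (Num 3))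
     (Seq (IfLess 18 25 var_code (IfLess 18 26 const_code (IfLess 18 27 add_code mul_code)))
     (Seq (put (Plus (Var 9) (Var 11)) 21) (assign 11 (Plus (Var 11) (Num 1)))))))))))))"

definition check_body :: com where
  "check_body = Seq (assign 22 (Mem (Plus (Var 9)
       (Plus (Times (Times (Minus (Var 5) (Num 1)) (Var 7)) (Var 7)) (Var 11)))))
     (Seq (IfLess 22 3 (assign 0 (Num 0)) (IfLess 3 22 (assign 0 (Num 0)) Skip))
     (assign 11 (Plus (Var 11) (Num 1))))"

definition pit_program :: com where
  "pit_program =
     Seq (assign 1 (Mem (Num 0))) (Seq (assign 2 (Mem (Num 1))) (Seq (assign 3 (Mem (Num 3)))
     (Seq (assign 4 (Mem (Num 4))) (Seq (assign 5 (Mem (Num 5)))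
     (Seq (assign 6 (Num 1)) (Seq (assign 10 (Times (Var 2) (Num 3)))
     (Seq (WhileLess 6 10 (assign 6 (Plus (Var 6) (Var 6))))
     (Seq (assign 7 (Times (Plus (Var 2) (Num 1)) (Var 6)))
     (Seq (assign 8 (Plus (Num 6) (Times (Var 5) (Num 3))))
     (Seq (assign 10 (Times (Var 7) (Var 1)))
     (Seq (assign 9 (Plus (Var 8) (Var 10)))
     (Seq (assign 11 (Num 0)) (Seq (WhileLess 11 10 gen_body)
     (Seq (assign 10 (Times (Times (Var 5) (Var 7)) (Var 7)))
     (Seq (assign 11 (Num 0)) (Seq (WhileLess 11 10 eval_body)
     (Seq (assign 0 (Num 1)) (Seq (assign 11 (Num 0)) (WhileLess 11 7 check_body)))))))))))))))))))"

section \<open>Layout of the input, and correctness of the program for a fixed list of coins\<close>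

lemma length_concat_gates [simp]: "length (concat (map gate_input C)) = 3 * length C"
proof (induction C)
  case (Cons g C)
  then show ?case by (cases g) auto
qed simp

lemma concat_gates_nth:
  "g < length C \<Longrightarrow> i < 3 \<Longrightarrow> concat (map gate_input C) ! (3 * g + i) = gate_input (C ! g) ! i"
proof (induction C arbitrary: g)
  case (Cons c C)
  have len: "length (gate_input c) = 3" by (cases c) auto
  show ?case
  proof (cases g)
    case 0
    then show ?thesis using Cons.prems len by (simp add: nth_append)
  next
    case (Suc g')
    have "\<not> 3 * g + i < length (gate_input c)" "3 * g + i - length (gate_input c) = 3 * g' + i"
      using Suc len by auto
    then show ?thesis using Suc Cons by (simp add: nth_append)
  qed
qed simp

lemma decode_encode [simp]: "length xs = m \<Longrightarrow> decode_bits m (encode_bits xs) = xs"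
  unfolding decode_bits_def encode_bits_def
  by (rule nth_equalityI) (auto simp: bit_horner_sum_bit_iff)

lemma encode_bits_inject: "length xs = length ys \<Longrightarrow> encode_bits xs = encode_bits ys \<longleftrightarrow> xs = ys"
  by (metis decode_encode)

text \<open>The coins \<open>bs0\<close> are fixed, so \<open>L\<close> is a concrete table.
  Minimality of \<open>l\<close> says that the doubling loop for \<open>K\<close> stops at
  \<open>2 ^ l\<close>, and \<open>B\<close> bounds the second factors and dividends met in the
  program's expressions.\<close>

locale pit_run = timed m R B + ring_automaton n d K L R
  for m n d K B :: nat and L :: "nat list" and R :: "bits ring" (structure) +
  fixes C :: "bits circuit" and l :: nat and bs0 :: bits
  assumes K_eq: "K = 2 ^ l" and L_eq: "L = chunks l (N * n) bs0" and carrier_length: "x \<in> carrier R \<Longrightarrow> length x = m"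
    and wf: "wf_circuit R n C"
    and l_least: "3 * d \<le> K" "j < l \<Longrightarrow> 2 ^ j < 3 * d"
    and bs0: "N * n * l \<le> length bs0"
    and B: "6 + 3 * length C + N * n + length C * N * N + N + n + K + 3 * d \<le> B"
begin

abbreviation "polys \<equiv> gate_polys R n C"

definition "table_base = 6 + 3 * length C"
definition "mat_base = table_base + N * n"
text \<open>For \<open>e < N * n\<close> this is \<open>delta (e div n) (e mod n)\<close>.\<close>

definition "table e = (e div n div K + 1) * K + L ! e"
definition "val e = ev (polys ! (e div N div N)) (e div N mod N) (e mod N)"

definition input_in :: "(nat \<Rightarrow> nat) \<Rightarrow> bool" where
  "input_in h \<longleftrightarrow> (\<forall>g<length C. \<forall>i<3. h (6 + 3 * g + i) = gate_input (C ! g) ! i)"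

definition env :: "(nat \<Rightarrow> nat) \<Rightarrow> bool" where
  "env r \<longleftrightarrow> r 1 = n \<and> r 3 = encode_bits \<zero> \<and> r 4 = encode_bits \<one> \<and> r 5 = length C \<and>
     r 6 = K \<and> r 7 = N \<and> r 8 = table_base \<and> r 9 = mat_base"

text \<open>Each table entry consumes exactly \<open>l\<close> coins. Knowing the unread coins ties
  the table in memory to the blocks of \<open>chunks\<close>.\<close>

definition gen_inv :: "nat \<Rightarrow> store \<Rightarrow> bool" where
  "gen_inv e = (\<lambda>(r, h, bs). env r \<and> input_in h \<and> r 10 = N * n \<and> r 11 = e \<and> bs = drop (e * l) bs0 \<and>
     (\<forall>e'<e. h (table_base + e') = table e'))"

definition gen_loop_inv :: "nat \<Rightarrow> (nat \<Rightarrow> nat) \<Rightarrow> nat \<Rightarrow> store \<Rightarrow> bool" where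
  "gen_loop_inv e h0 j = (\<lambda>(r, h, bs). env r \<and> h = h0 \<and> r 10 = N * n \<and> r 11 = e \<and> bs = drop (e * l + j) bs0 \<and>
     r 12 = horner_bits 0 (take j (drop (e * l) bs0)) \<and> r 13 = 2 ^ j)"

lemma envD:
  assumes "env r"
  shows "r (Suc 0) = n" "r 3 = encode_bits \<zero>" "r 4 = encode_bits \<one>" "r 5 = length C"
     "r 6 = K" "r 7 = N" "r 8 = table_base" "r 9 = mat_base"
  using assms by (simp_all add: env_def)

lemma env_upd [simp]: "env (r(x := v)) \<longleftrightarrow> env r" if "x = 0 \<or> x = 2 \<or> 9 < x"
  using that by (auto simp: env_def)

lemma B_le: "N * n \<le> B" "length C * N * N \<le> B" "N \<le> B" "n \<le> B" "K \<le> B" "3 * d \<le> B" "3 \<le> B"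
  "length C \<le> B"
  using B by linarith+

lemma pow_less_K: "j < l \<Longrightarrow> 2 ^ j < K"
  by (simp add: K_eq)

lemma gen_loop_correct:
  assumes "e < N * n" "j < l" "gen_loop_inv e h0 j s"
  shows "wp gen_loop 10 (gen_loop_inv e h0 (Suc j)) s"
proof -
  obtain r h bs where s: "s = (r, h, bs)" by (cases s)
  have "e * l + j < (e + 1) * l" using assms by simp
  also have "\<dots> \<le> (N * n) * l" using assms by (intro mult_le_mono1) simp
  also have "\<dots> \<le> length bs0" using bs0 by simp
  finally have len: "e * l + j < length bs0" .
  have take: "take (Suc j) (drop (e * l) bs0) = take j (drop (e * l) bs0) @ [hd (drop (e * l + j) bs0)]"
    using len by (simp add: take_Suc_conv_app_nth hd_drop_conv_nth)
  have tl: "tl (drop (e * l + j) bs0) = drop (e * l + Suc j) bs0"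
    by (simp add: drop_Suc tl_drop)
  show ?thesis unfolding s gen_loop_def
    apply (rule wp_assign_Seq)
       apply simp
      apply (simp add: small_def)
     apply simp
    apply (rule wp_Coin_Seq)
       apply simp
    subgoal using assms len s by (auto simp: gen_loop_inv_def)
     apply simp
    apply (rule wp_assign_Seq)
       apply simp
      apply (simp add: small_def)
     apply simp
    apply (rule wp_assign)
       apply simp
      apply (simp add: small_def)
     apply simp
    using assms tl take s by (auto simp: gen_loop_inv_def horner_bits_def)
qed

text \<open>The program never computes \<open>l\<close>: register 13 doubles from 1 up to
  \<open>K\<close>, which takes exactly \<open>l\<close> rounds and hence \<open>l\<close>
  coins.\<close>

lemma gen_body_correct:
  assumes "e < N * n" "gen_inv e s"
  shows "wp gen_body (11 * l + 20) (gen_inv (Suc e)) s"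
proof -
  obtain r h bs where s: "s = (r, h, bs)" by (cases s)
  have n: "0 < n" using assms by (auto intro: Nat.gr0I)
  have e: "e div n \<le> B" "e \<le> B" using assms(1) B_le(1) div_le_dividend[of e n] by linarith+
  have Le: "horner_bits 0 (take l (drop (e * l) bs0)) = L ! e"
    using assms(1) by (simp add: chunks_nth L_eq)
  show ?thesis unfolding s gen_body_def
    apply (rule wp_assign_Seq)
       apply simp
      apply (simp add: small_def)
     apply simp
    apply (rule wp_assign_Seq)
       apply simp
      apply (simp add: small_def)
     apply simp
    apply (rule wp_Seq[of _ "11 * l + 1" _ 10])
    subgoal
      apply (rule wp_WhileLess[where I = "gen_loop_inv e h" and k = l and b = 10])
           apply simp
          apply simp
      subgoal for j r' h' bs'
        using gen_loop_correct[OF assms(1), of j h "(r', h', bs')"]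
        pow_less_K[of j]
        by (auto simp: gen_loop_inv_def dest: envD)
      subgoal for r' h' bs'
        apply (rule conjI)
         apply (simp add: gen_loop_inv_def envD K_eq[symmetric])
        apply (rule wp_assign_Seq)
           apply simp
        subgoal using n e B_le K_pos by (simp add: small_def gen_loop_inv_def envD)
         apply simp
        apply (rule wp_put_Seq)
           apply simp
          apply (simp add: small_def)
         apply simp
        apply (rule wp_assign)
           apply simp
          apply (simp add: small_def)
         apply simp
        using assms s Le by (auto simp: gen_loop_inv_def gen_inv_def envD table_def less_Suc_eq input_in_def table_base_def add.commute)
      subgoal using assms s by (auto simp: gen_inv_def gen_loop_inv_def horner_bits_def)
      by simp
    by simp
qed

definition mat_in :: "nat \<Rightarrow> (nat \<Rightarrow> nat) \<Rightarrow> bool" where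
  "mat_in e h \<longleftrightarrow> (\<forall>e'<e. h (mat_base + e') = encode_bits (val e'))"

definition eval_inv :: "nat \<Rightarrow> store \<Rightarrow> bool" where
  "eval_inv e = (\<lambda>(r, h, bs). env r \<and> input_in h \<and> r 10 = length C * N * N \<and> r 11 = e \<and>
     (\<forall>e'<N * n. h (table_base + e') = table e') \<and> mat_in e h)"

definition gate_inv :: "nat \<Rightarrow> nat \<Rightarrow> nat \<Rightarrow> store \<Rightarrow> bool" where
  "gate_inv e a b = (\<lambda>(r, h, bs). eval_inv e (r, h, bs) \<and> r 15 = e mod N \<and> r 16 = e div N mod N \<and>
     r 19 = a \<and> r 20 = b)"

definition mul_inv :: "nat \<Rightarrow> nat \<Rightarrow> nat \<Rightarrow> nat \<Rightarrow> store \<Rightarrow> bool" where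
  "mul_inv e a b j = (\<lambda>(r, h, bs). gate_inv e a b (r, h, bs) \<and> r 24 = j \<and>
     r 21 = encode_bits (\<Oplus>s\<in>{..<j}. val ((a * N + e div N mod N) * N + s) \<otimes> val ((b * N + s) * N + e mod N)))"

definition val_inv :: "nat \<Rightarrow> store \<Rightarrow> bool" where
  "val_inv e = (\<lambda>(r, h, bs). eval_inv e (r, h, bs) \<and> r 21 = encode_bits (val e))"

lemma N_pos: "0 < N"
  using K_pos by (simp add: N_def)

lemma gate_inv_upd [simp]:
  "x \<in> {12, 13, 14, 17, 18, 21, 22, 23, 24, 25, 26, 27} \<Longrightarrow> gate_inv e a b (r(x := v), h, bs) = gate_inv e a b (r, h, bs)"
  by (auto simp: gate_inv_def eval_inv_def)

lemma eval_inv_upd [simp]: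
  "x \<in> {0, 12, 13, 14, 15, 16, 17, 18, 19, 20, 21, 22, 23, 24, 25, 26, 27} \<Longrightarrow> eval_inv e (r(x := v), h, bs) = eval_inv e (r, h, bs)"
  by (auto simp: eval_inv_def)

lemma gate_invD:
  assumes "gate_inv e a b (r, h, bs)"
  shows "env r" "r 15 = e mod N" "r 16 = e div N mod N" "r 19 = a" "r 20 = b" "eval_inv e (r, h, bs)" "mat_in e h"
    "r 11 = e"
  using assms by (auto simp: gate_inv_def eval_inv_def)

lemma wf_gates: "p < length C \<Longrightarrow> wf_gate R n p (C ! p)"
  using wf by (simp add: wf_circuit_def)

lemma polys_closed: "g < length C \<Longrightarrow> (polys ! g) w \<in> carrier R"
  using gate_polys_closed[of C n g] wf_gates by (auto simp: free_algebra_def)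

lemma polys_nth: "g < length C \<Longrightarrow> polys ! g = gate_poly R n polys (C ! g)"
  by (rule gate_polys_nth) (use wf_gates in auto)

lemma gate_of_less: "e < length C * N * N \<Longrightarrow> e div N div N < length C"
  using N_pos by (simp add: less_mult_imp_div_less)

lemma val_closed: "e < length C * N * N \<Longrightarrow> val e \<in> carrier R"
  unfolding val_def by (intro ev_closed polys_closed gate_of_less)

lemma entry_div:
  assumes "p < N" "q < N"
  shows "((j * N + p) * N + q) mod N = q" "((j * N + p) * N + q) div N mod N = p" "((j * N + p) * N + q) div N div N = j"
  using assms by auto

text \<open>The gate is the leading digit of an offset, so all entries of an earlier gate come
  before \<open>e\<close> and are covered by \<open>mat_in e\<close>.\<close>

lemma entry_less:
  assumes "p < N" "q < N" "j < e div N div N"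
  shows "(j * N + p) * N + q < e"
proof (rule ccontr)
  assume "\<not> ?thesis"
  then have "e div N div N \<le> ((j * N + p) * N + q) div N div N" by (intro div_le_mono) simp
  then show False using assms entry_div(3)[OF assms(1,2), of j] by simp
qed

lemma val_entry: "p < N \<Longrightarrow> q < N \<Longrightarrow> val ((j * N + p) * N + q) = ev (polys ! j) p q"
  unfolding val_def by (simp only: entry_div(1,2,3))

lemma decode_enc: "x \<in> carrier R \<Longrightarrow> decode_bits m (encode_bits x) = x"
  by (simp add: carrier_length)

context
  fixes e assumes e: "e < length C * N * N"
begin

lemma val_unfold: "val e = ev (gate_poly R n polys (C ! (e div N div N))) (e div N mod N) (e mod N)"
  unfolding val_def polys_nth[OF gate_of_less[OF e]] ..

lemma val_var:
  assumes "C ! (e div N div N) = VarGate i"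
  shows "i < n" "val e = (if table ((e div N mod N) * n + i) = e mod N then \<one> else \<zero>)"
    "(e div N mod N) * n + i < N * n"
proof -
  show i: "i < n" using wf_gates[OF gate_of_less[OF e]] assms by simp
  have p: "e div N mod N < N" using N_pos by simp
  have "delta (e div N mod N) i = table ((e div N mod N) * n + i)"
    using p i by (simp add: delta_def table_def)
  then show "val e = (if table ((e div N mod N) * n + i) = e mod N then \<one> else \<zero>)"
    using ev_indicator[of "e mod N" \<one> "[i]" "e div N mod N"] N_pos i assms
    by (simp add: val_unfold nc_var_def)
  have "(e div N mod N) * n + i < Suc (e div N mod N) * n" using i by simp
  also have "\<dots> \<le> N * n" using p by (intro mult_le_mono1) simp
  finally show "(e div N mod N) * n + i < N * n" .
qed

lemma val_const:
  assumes "C ! (e div N div N) = ConstGate a"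
  shows "val e = (if e div N mod N = e mod N then a else \<zero>)"
  using ev_indicator[of "e mod N" a "[]" "e div N mod N"] N_pos wf_gates[OF gate_of_less[OF e]] assms
  by (simp add: val_unfold nc_const_def)

lemma val_add:
  assumes "C ! (e div N div N) = AddGate j k"
  shows "j < e div N div N" "k < e div N div N"
    "val e = val ((j * N + e div N mod N) * N + e mod N) \<oplus> val ((k * N + e div N mod N) * N + e mod N)"
proof -
  show jk: "j < e div N div N" "k < e div N div N" using wf_gates[OF gate_of_less[OF e]] assms by auto
  then show "val e = val ((j * N + e div N mod N) * N + e mod N) \<oplus> val ((k * N + e div N mod N) * N + e mod N)"
    using N_pos assms gate_of_less[OF e] 
    by (simp add: val_entry val_unfold free_algebra_def ev_add polys_closed)
qed

lemma val_mul:
  assumes "C ! (e div N div N) = MulGate j k"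
  shows "j < e div N div N" "k < e div N div N"
    "val e = (\<Oplus>s\<in>{..<N}. val ((j * N + e div N mod N) * N + s) \<otimes> val ((k * N + s) * N + e mod N))"
proof -
  show jk: "j < e div N div N" "k < e div N div N" using wf_gates[OF gate_of_less[OF e]] assms by auto
  have "val e = (\<Oplus>s\<in>{..<N}. ev (polys ! j) (e div N mod N) s \<otimes> ev (polys ! k) s (e mod N))"
    using N_pos assms gate_of_less[OF e] jk
    by (simp add: val_unfold free_algebra_def ev_mult polys_closed)
  also have "\<dots> = (\<Oplus>s\<in>{..<N}. val ((j * N + e div N mod N) * N + s) \<otimes> val ((k * N + s) * N + e mod N))"
    using N_pos jk gate_of_less[OF e]
    by (intro finsum_cong') (auto simp: val_entry ev_closed polys_closed)
  finally show "val e = (\<Oplus>s\<in>{..<N}. val ((j * N + e div N mod N) * N + s) \<otimes> val ((k * N + s) * N + e mod N))" .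
qed

lemma mat_inD:
  assumes "mat_in e h" "j < e div N div N" "p < N" "q < N"
  shows "h (mat_base + ((j * N + p) * N + q)) = encode_bits (val ((j * N + p) * N + q))"
    "val ((j * N + p) * N + q) \<in> carrier R"
  using assms entry_less[OF assms(3,4,2)] e by (auto simp: mat_in_def intro: val_closed)

lemma var_code_correct:
  assumes "gate_inv e i b (r, h, bs)" "C ! (e div N div N) = VarGate i"
  shows "wp var_code 10 (val_inv e) (r, h, bs)"
proof -
  note v = val_var[OF assms(2)] note g = gate_invD[OF assms(1)]
  have t: "h (table_base + ((e div N mod N) * n + i)) = table ((e div N mod N) * n + i)"
    using v(3) g(6) by (simp add: eval_inv_def)
  show ?thesis unfolding var_code_def
    apply (rule wp_assign_Seq)
       apply simp
    subgoal using B_le g by (simp add: small_def envD)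
     apply simp
    apply (rule wp_assign_Seq)
       apply simp
      apply (simp add: small_def)
     apply simp
    apply (rule wp_If_eq)
        apply simp
       apply simp
      apply simp
    subgoal
      apply (rule wp_assign)
         apply simp
        apply (simp add: small_def)
       apply simp
      using g t v by (simp add: envD val_inv_def)
    subgoal
      apply (rule wp_Skip)
      using g t v by (simp add: envD val_inv_def)
    done
qed

lemma const_code_correct:
  assumes "gate_inv e (encode_bits a) b (r, h, bs)" "C ! (e div N div N) = ConstGate a"
  shows "wp const_code 10 (val_inv e) (r, h, bs)"
proof -
  note v = val_const[OF assms(2)] note g = gate_invD[OF assms(1)]
  show ?thesis unfolding const_code_def
    apply (rule wp_assign_Seq)
       apply simp
      apply (simp add: small_def)
     apply simp
    apply (rule wp_If_eq)
        apply simp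
       apply simp
      apply simp
    subgoal
      apply (rule wp_assign)
         apply simp
        apply (simp add: small_def)
       apply simp
      using g v by (simp add: envD val_inv_def)
    subgoal
      apply (rule wp_Skip)
      using g v by (simp add: envD val_inv_def)
    done
qed

lemma add_code_correct:
  assumes "gate_inv e j k (r, h, bs)" "C ! (e div N div N) = AddGate j k"
  shows "wp add_code 10 (val_inv e) (r, h, bs)"
proof -
  note v = val_add[OF assms(2)] note g = gate_invD[OF assms(1)]
  have pq: "e div N mod N < N" "e mod N < N" using N_pos by auto
  note mj = mat_inD[OF g(7) v(1) pq] note mk = mat_inD[OF g(7) v(2) pq]
  show ?thesis unfolding add_code_def
    apply (rule wp_assign_Seq)
       apply simp
    subgoal using B_le g by (simp add: small_def envD)
     apply simp
    apply (rule wp_assign_Seq)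
       apply simp
    subgoal using B_le g by (simp add: small_def envD)
     apply simp
    apply (rule wp_RingAdd)
        apply simp
       apply simp
      apply simp
     apply simp
    using g mj mk v(3) by (simp add: envD val_inv_def decode_enc)
qed

lemma mul_loop_correct:
  assumes "mul_inv e j k s (r, h, bs)" "C ! (e div N div N) = MulGate j k" "s < N"
  shows "wp mul_loop 12 (mul_inv e j k (Suc s)) (r, h, bs)"
proof -
  note v = val_mul[OF assms(2)]
  have gi: "gate_inv e j k (r, h, bs)" using assms(1) by (simp add: mul_inv_def)
  note g = gate_invD[OF gi]
  have pq: "e div N mod N < N" "e mod N < N" using N_pos by auto
  note mj = mat_inD[OF g(7) v(1) pq(1)] note mk = mat_inD[OF g(7) v(2) _ pq(2)]
  have sum: "(\<Oplus>s\<in>{..<Suc s}. val ((j * N + e div N mod N) * N + s) \<otimes> val ((k * N + s) * N + e mod N)) =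
     (\<Oplus>s\<in>{..<s}. val ((j * N + e div N mod N) * N + s) \<otimes> val ((k * N + s) * N + e mod N)) \<oplus>
     val ((j * N + e div N mod N) * N + s) \<otimes> val ((k * N + s) * N + e mod N)"
    unfolding lessThan_Suc using assms(3) mj mk
    by (subst finsum_insert) (auto intro!: a_comm finsum_closed)
  have closed: "(\<Oplus>s\<in>{..<s}. val ((j * N + e div N mod N) * N + s) \<otimes> val ((k * N + s) * N + e mod N)) \<in> carrier R"
    using assms(3) mj mk by (intro finsum_closed) auto
  show ?thesis unfolding mul_loop_def
    apply (rule wp_assign_Seq)
       apply simp
    subgoal using B_le g by (simp add: small_def envD)
     apply simp
    apply (rule wp_assign_Seq)
       apply simp
    subgoal using B_le g by (simp add: small_def envD)
     apply simp
    apply (rule wp_RingMul_Seq)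
        apply simp
       apply simp
      apply simp
     apply simp
    apply (rule wp_RingAdd_Seq)
        apply simp
       apply simp
      apply simp
     apply simp
    apply (rule wp_assign)
       apply simp
      apply (simp add: small_def)
     apply simp
    using assms(1,3) g gi mj mk sum closed by (simp add: envD mul_inv_def decode_enc)
qed

lemma mul_code_correct:
  assumes "gate_inv e j k (r, h, bs)" "C ! (e div N div N) = MulGate j k"
  shows "wp mul_code (13 * N + 10) (val_inv e) (r, h, bs)"
  unfolding mul_code_def
  apply (rule wp_assign_Seq)
     apply simp
    apply (simp add: small_def)
   apply simp
  apply (rule wp_assign_Seq)
     apply simp
    apply (simp add: small_def)
   apply simp
  apply (rule wp_WhileLess[where I = "mul_inv e j k" and k = N and b = 12])
       apply simp
      apply simp
  subgoal for s r' h' bs'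
    using mul_loop_correct[OF _ assms(2), of s r' h' bs'] gate_invD(1)[of e j k r' h' bs']
    by (auto simp: mul_inv_def envD)
  subgoal for r' h' bs'
    using gate_invD[of e j k r' h' bs'] val_mul(3)[OF assms(2)]
    by (auto simp: mul_inv_def envD val_inv_def)
  subgoal using assms gate_invD(1)[OF assms(1)] by (simp add: mul_inv_def envD)
  by simp

lemma eval_body_correct:
  assumes "eval_inv e s"
  shows "wp eval_body (13 * N + 40) (eval_inv (Suc e)) s"
proof -
  obtain r h bs where s: "s = (r, h, bs)" by (cases s)
  define g where "g = e div N div N"
  have g: "g < length C" using gate_of_less[OF e] by (simp add: g_def)
  have env: "env r" and inp: "input_in h" and r11: "r 11 = e" using assms by (auto simp: s eval_inv_def)
  have eB: "e \<le> B" "e div N \<le> B" "e div N div N \<le> B"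
    using e B_le(2) div_le_dividend[of e N] div_le_dividend[of "e div N" N] by linarith+
  have in0: "h (6 + g * 3) = gate_input (C ! g) ! 0" "h (7 + g * 3) = gate_input (C ! g) ! 1"
    "h (8 + g * 3) = gate_input (C ! g) ! 2"
    using inp[unfolded input_in_def, rule_format, OF g, of 0] inp[unfolded input_in_def, rule_format, OF g, of 1]
      inp[unfolded input_in_def, rule_format, OF g, of 2]
    by (simp_all add: mult.commute)
  let ?r = "\<lambda>r'. r' 25 = 1 \<and> r' 26 = 2 \<and> r' 27 = 3 \<and> r' 18 = h (6 + g * 3)"
  \<comment> \<open>The cost of multiplication, the slowest branch, is charged for every kind of
    gate; three more units pay for the nested tests.\<close>
  define w where "w = 13 * N + 10"
  have branch: "wp (IfLess 18 25 var_code (IfLess 18 26 const_code (IfLess 18 27 add_code mul_code)))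
      (w + 3) (val_inv e) (r', h, bs)"
    if gi: "gate_inv e (h (7 + g * 3)) (h (8 + g * 3)) (r', h, bs)" and r': "?r r'" for r'
  proof (cases "C ! g")
    case (VarGate i)
    have "wp var_code (w + 2) (val_inv e) (r', h, bs)"
      by (rule wp_mono[OF var_code_correct]) (use gi in0 VarGate in \<open>auto simp: g_def w_def\<close>)
    then show ?thesis using r' in0 VarGate by (intro wp_IfLess) auto
  next
    case (ConstGate a)
    have "wp const_code (w + 1) (val_inv e) (r', h, bs)"
      by (rule wp_mono[OF const_code_correct]) (use gi in0 ConstGate in \<open>auto simp: g_def w_def\<close>)
    then show ?thesis using r' in0 ConstGate by (intro wp_IfLess) auto
  next
    case (AddGate j k)
    have "wp add_code w (val_inv e) (r', h, bs)"
      by (rule wp_mono[OF add_code_correct]) (use gi in0 AddGate in \<open>auto simp: g_def w_def\<close>)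
    then show ?thesis using r' in0 AddGate by (intro wp_IfLess) auto
  next
    case (MulGate j k)
    have "wp mul_code w (val_inv e) (r', h, bs)"
      by (rule wp_mono[OF mul_code_correct]) (use gi in0 MulGate in \<open>auto simp: g_def w_def\<close>)
    then show ?thesis using r' in0 MulGate by (intro wp_IfLess) auto
  qed
  show ?thesis unfolding s eval_body_def
    apply (rule wp_assign_Seq)
       apply simp
    subgoal using N_pos eB B_le env r11 by (simp add: small_def envD)
     apply simp
    apply (rule wp_assign_Seq)
       apply simp
    subgoal using N_pos eB B_le env r11 by (simp add: small_def envD)
     apply simp
    apply (rule wp_assign_Seq)
       apply simp
    subgoal using N_pos eB B_le env r11 by (simp add: small_def envD)
     apply simp
    apply (rule wp_assign_Seq)
       apply simp
    subgoal using B_le by (simp add: small_def)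
     apply simp
    apply (rule wp_assign_Seq)
       apply simp
    subgoal using B_le by (simp add: small_def)
     apply simp
    apply (rule wp_assign_Seq)
       apply simp
    subgoal using B_le by (simp add: small_def)
     apply simp
    apply (rule wp_assign_Seq)
       apply simp
      apply (simp add: small_def)
     apply simp
    apply (rule wp_assign_Seq)
       apply simp
      apply (simp add: small_def)
     apply simp
    apply (rule wp_assign_Seq)
       apply simp
      apply (simp add: small_def)
     apply simp
    apply (rule wp_Seq[of _ "w + 3" _ 5])
     apply (rule wp_mono[OF branch])
    subgoal
      using assms env r11 by (simp add: s gate_inv_def envD g_def minus_div_mult_eq_mod)
    subgoal using env r11 by (simp add: envD g_def)
      apply simp
    subgoal for r' h' bs'
      apply (rule wp_put_Seq)
         apply simp
        apply (simp add: small_def)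
       apply simp
      apply (rule wp_assign)
         apply simp
        apply (simp add: small_def)
       apply simp
      \<comment> \<open>The write goes to \<open>mat_base + e\<close>, beyond the input, the table
        and all earlier entries.\<close>
      using e by (auto simp: val_inv_def eval_inv_def envD mat_in_def less_Suc_eq input_in_def
          table_base_def mat_base_def)
    by (simp add: w_def)
qed

end

definition check_inv :: "nat \<Rightarrow> store \<Rightarrow> bool" where
  "check_inv j = (\<lambda>(r, h, bs). env r \<and> mat_in (length C * N * N) h \<and> r 11 = j \<and>
     r 0 = of_bool (\<forall>q<j. ev (circuit_poly R n C) 0 q = \<zero>))"

lemma check_body_correct:
  assumes "q < N" "check_inv q (r, h, bs)"
  shows "wp check_body 10 (check_inv (Suc q)) (r, h, bs)"
proof -
  have C: "C \<noteq> []" using wf by (simp add: wf_circuit_def)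
  \<comment> \<open>The output gate is the last one, and the checked row belongs to the start state
    0.\<close>
  let ?e = "((length C - 1) * N + 0) * N + q"
  have env: "env r" "r 11 = q" "r 0 = of_bool (\<forall>q'<q. ev (circuit_poly R n C) 0 q' = \<zero>)" using assms by (auto simp: check_inv_def)
  have "?e < (length C - 1) * N * N + N" using assms by simp
  also have "\<dots> \<le> (length C - 1) * N * N + N * N" using N_pos by simp
  also have "\<dots> = length C * N * N" using C by (cases C) (auto simp: algebra_simps)
  finally have e: "?e < length C * N * N" .
  have "h (mat_base + ?e) = encode_bits (ev (circuit_poly R n C) 0 q)"
    using assms e val_entry[OF N_pos assms(1), of "length C - 1"]
    unfolding check_inv_def mat_in_def circuit_poly_eq_nth[OF C] by simp
  then have h: "h (mat_base + ((length C - Suc 0) * N * N + q)) = encode_bits (ev (circuit_poly R n C) 0 q)"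
    by simp
  have cl: "ev (circuit_poly R n C) 0 q \<in> carrier R"
    using C by (auto intro!: ev_closed polys_closed simp: circuit_poly_eq_nth)
  \<comment> \<open>Encodings of strings of length \<open>m\<close> are injective, so comparing
    numbers decides whether the ring element is zero.\<close>
  have eq: "encode_bits (ev (circuit_poly R n C) 0 q) = encode_bits \<zero> \<longleftrightarrow> ev (circuit_poly R n C) 0 q = \<zero>"
    using cl by (intro encode_bits_inject) (simp add: carrier_length)
  show ?thesis unfolding check_body_def
    apply (rule wp_assign_Seq)
       apply simp
    subgoal using B_le env by (simp add: small_def envD)
     apply simp
    apply (rule wp_Seq[of _ 4 _ 2])
     apply (rule wp_If_eq)
         apply simp
        apply simp
       apply simp
    subgoal
      apply (rule wp_Skip)
      apply (rule wp_assign)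
         apply simp
        apply (simp add: small_def)
       apply simp
      using assms env eq h by (auto simp: check_inv_def envD less_Suc_eq)
    subgoal
      apply (rule wp_assign)
         apply simp
        apply (simp add: small_def)
       apply simp
      apply (rule wp_assign)
         apply simp
        apply (simp add: small_def)
       apply simp
      using assms env eq h by (auto simp: check_inv_def envD less_Suc_eq)
    by simp
qed

definition setup_inv :: "nat \<Rightarrow> store \<Rightarrow> bool" where
  "setup_inv j = (\<lambda>(r, h, bs). r 1 = n \<and> r 2 = d \<and> r 3 = encode_bits \<zero> \<and> r 4 = encode_bits \<one> \<and> r 5 = length C \<and>
     r 6 = 2 ^ j \<and> r 10 = d * 3 \<and> input_in h \<and> bs = bs0)"

text \<open>The first four summands are the loops that find \<open>K\<close>, draw the table,
  evaluate the gates and check the row; \<open>35\<close> pays for the code between them.\<close>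

lemma pit_program_wp:
  assumes "h 0 = n" "h 1 = d" "h 3 = encode_bits \<zero>" "h 4 = encode_bits \<one>" "h 5 = length C" "input_in h"
  shows "wp pit_program ((l * 2 + 1) + (N * n * (11 * l + 21) + 1) + (length C * N * N * (13 * N + 41) + 1) + (N * 11 + 1) + 35)
    (\<lambda>(r, h, bs). r 0 = of_bool (\<forall>q<N. ev (circuit_poly R n C) 0 q = \<zero>)) (r, h, bs0)"
proof -
  define a1 where "a1 = l * 2 + 1"
  define a2 where "a2 = N * n * (11 * l + 21) + 1"
  define a3 where "a3 = length C * N * N * (13 * N + 41) + 1"
  define a4 where "a4 = N * 11 + 1"
  have *: "wp pit_program (a1 + a2 + a3 + a4 + 35)
    (\<lambda>(r, h, bs). r 0 = of_bool (\<forall>q<N. ev (circuit_poly R n C) 0 q = \<zero>)) (r, h, bs0)"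
    unfolding pit_program_def
    apply (rule wp_assign_Seq, simp, simp add: small_def, simp)
    apply (rule wp_assign_Seq, simp, simp add: small_def, simp)
    apply (rule wp_assign_Seq, simp, simp add: small_def, simp)
    apply (rule wp_assign_Seq, simp, simp add: small_def, simp)
    apply (rule wp_assign_Seq, simp, simp add: small_def, simp)
    apply (rule wp_assign_Seq, simp, simp add: small_def, simp)
    apply (rule wp_assign_Seq, simp, use B_le in \<open>simp add: small_def\<close>, simp)
    apply (rule wp_Seq[of _ a1 _ "a2 + a3 + a4 + 20"])
     apply (rule wp_WhileLess[where I = setup_inv and k = l and b = 1])
          apply simp
         apply simp
    subgoal for j r h bs
      apply (rule conjI)
      subgoal using l_least(2) by (simp add: setup_inv_def mult.commute)
      apply (rule wp_assign, simp, simp add: small_def, simp)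
      by (simp add: setup_inv_def)
    subgoal for r h bs
      apply (rule conjI)
      subgoal using l_least(1) by (simp add: setup_inv_def mult.commute K_eq)
      apply (rule wp_assign_Seq, simp, use B_le in \<open>simp add: small_def setup_inv_def K_eq\<close>, simp)
      apply (rule wp_assign_Seq, simp, use B_le in \<open>simp add: small_def setup_inv_def\<close>, simp)
      apply (rule wp_assign_Seq, simp, use B_le in \<open>simp add: small_def setup_inv_def\<close>, simp)
      apply (rule wp_assign_Seq, simp, use B_le in \<open>simp add: small_def setup_inv_def\<close>, simp)
      apply (rule wp_assign_Seq, simp, simp add: small_def, simp)
      apply (rule wp_Seq[of _ a2 _ "a3 + a4 + 9"])
       apply (rule wp_WhileLess[where I = gen_inv and k = "N * n" and b = "11 * l + 20"])
            apply simp
           apply simp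
      subgoal for e r h bs
        using gen_body_correct[of e "(r, h, bs)"] by (simp add: gen_inv_def)
      subgoal for r h bs
        apply (rule conjI)
         apply (simp add: gen_inv_def)
        apply (rule wp_assign_Seq, simp, use B_le in \<open>simp add: small_def gen_inv_def envD\<close>, simp)
        apply (rule wp_assign_Seq, simp, simp add: small_def, simp)
        apply (rule wp_Seq[of _ a3 _ "a4 + 4"])
         apply (rule wp_WhileLess[where I = eval_inv and k = "length C * N * N" and b = "13 * N + 40"])
              apply simp
             apply simp
        subgoal for e r h bs
          using eval_body_correct[of e "(r, h, bs)"] by (simp add: eval_inv_def)
        subgoal for r h bs
          apply (rule conjI)
           apply (simp add: eval_inv_def)
          apply (rule wp_assign_Seq, simp, simp add: small_def, simp)
          apply (rule wp_assign_Seq, simp, simp add: small_def, simp add: a4_def)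
          apply (rule wp_WhileLess[where I = check_inv and k = N and b = 10])
               apply simp
              apply simp
          subgoal for q r h bs
            using check_body_correct[of q r h bs] by (auto simp: check_inv_def envD)
          subgoal for r h bs
            by (auto simp: check_inv_def envD)
          subgoal by (auto simp: check_inv_def eval_inv_def)
          by (simp add: a4_def)
        subgoal by (auto simp: gen_inv_def eval_inv_def envD mat_in_def)
         apply (simp add: a3_def algebra_simps)
        by simp
      subgoal by (simp add: gen_inv_def setup_inv_def env_def N_def K_eq[symmetric] table_base_def mat_base_def
            mult.commute add.assoc)
       apply (simp add: a2_def algebra_simps)
      by simp
    subgoal using assms by (auto simp: setup_inv_def)
     apply (simp add: a1_def)
    by simp
  then show ?thesis unfolding a1_def a2_def a3_def a4_def .
qed

text \<open>The program needs at most \<open>160 * (B * B)\<close> units of at most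
  \<open>800 * B\<close> steps, which gives the factor 128000. Idling on \<open>Skip\<close> extends
  the run to every larger \<open>T\<close>.\<close>

lemma pit_program_drun:
  assumes "128000 * B ^ 3 \<le> T"
  shows "\<exists>r h bs. drun m R T (start pit_program (pit_input m R n d C), bs0) = ((Skip, r, h), bs) \<and>
    r 0 = of_bool (\<forall>q<N. ev (circuit_poly R n C) 0 q = \<zero>)"
proof -
  define h where "h = (\<lambda>a. if a < length (pit_input m R n d C) then pit_input m R n d C ! a else 0)"
  have "h (6 + 3 * g + i) = gate_input (C ! g) ! i" if "g < length C" "i < 3" for g i
  proof -
    have "3 * g + i < 3 * length C" using that by linarith
    then show ?thesis using concat_gates_nth[OF that] by (simp add: h_def pit_input_def nth_append add.assoc)
  qed
  then have inp: "input_in h" by (simp add: input_in_def)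
  let ?t = "(l * 2 + 1) + (N * n * (11 * l + 21) + 1) + (length C * N * N * (13 * N + 41) + 1) + (N * 11 + 1) + 35"
  have "wp pit_program ?t
    (\<lambda>(r, h, bs). r 0 = of_bool (\<forall>q<N. ev (circuit_poly R n C) 0 q = \<zero>)) (\<lambda>_. 0, h, bs0)"
    by (rule pit_program_wp[OF _ _ _ _ _ inp]) (simp_all add: h_def pit_input_def)
  from wpD[OF this, of "\<lambda>_. 0"] obtain t r' h' bs' where
    t: "t \<le> ?t * time_unit" "drun m R t ((pit_program, \<lambda>_. 0, h), bs0) = ((Skip, r', h'), bs')"
    "r' 0 = of_bool (\<forall>q<N. ev (circuit_poly R n C) 0 q = \<zero>)"
    unfolding reaches_def by (auto simp: agree_def)
  have lB: "l \<le> B" using B_le(5) less_exp[of l] unfolding K_eq by linarith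
  have B1: "1 \<le> B" using B_le by simp
  have "?t \<le> (B * 2 + 1) + (B * (11 * B + 21) + 1) + (B * (13 * B + 41) + 1) + (B * 11 + 1) + 35"
    using lB B_le by (intro add_mono mult_mono) auto
  also have "\<dots> = 24 * (B * B) + 75 * B + 39" by (simp add: algebra_simps)
  also have "\<dots> \<le> 160 * (B * B)"
    using B1 mult_le_mono1[OF B1, of B] by linarith
  finally have "?t \<le> 160 * (B * B)" .
  moreover have "time_unit \<le> 800 * B" using B1 by (simp add: time_unit_def)
  ultimately have "?t * time_unit \<le> (160 * (B * B)) * (800 * B)" by (rule mult_le_mono)
  also have "\<dots> = 128000 * B ^ 3" by (simp add: power3_eq_cube)
  finally have "t \<le> T" using t(1) assms by linarith
  then have "drun m R T ((pit_program, \<lambda>_. 0, h), bs0) = ((Skip, r', h'), bs')"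
    using drun_add[of m R t "T - t"] t(2) by simp
  then show ?thesis using t(3) by (auto simp: start_def h_def[symmetric])
qed

end

text \<open>The fifth power comes from \<open>len * N * N\<close>, as \<open>N\<close> is at most
  \<open>14 * S ^ 2\<close>. Its coefficient is \<open>14 * 14 = 196\<close>; the other summands
  contribute at most 48.\<close>

lemma B_bound:
  fixes S n d len K N :: nat
  assumes "1 \<le> S" "n \<le> S" "d \<le> S" "len \<le> S" "K \<le> 7 * S" "N = (d + 1) * K"
  shows "6 + 3 * len + N * n + len * N * N + N + n + K + 3 * d \<le> 300 * S ^ 5"
proof -
  have N: "N \<le> 14 * S ^ 2"
  proof -
    have "(d + 1) * K \<le> (2 * S) * (7 * S)" using assms by (intro mult_le_mono) auto
    then show ?thesis using assms by (simp add: power2_eq_square)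
  qed
  have "N * n \<le> (14 * S ^ 2) * S" using N assms by (intro mult_le_mono) auto
  then have 1: "N * n \<le> 14 * S ^ 3" by (simp add: power2_eq_square power3_eq_cube)
  have "len * N * N \<le> S * (14 * S ^ 2) * (14 * S ^ 2)" using N assms by (intro mult_le_mono) auto
  then have 2: "len * N * N \<le> 196 * S ^ 5" by (simp add: power_numeral_reduce)
  have p: "1 \<le> S ^ 5" "S \<le> S ^ 5" "S ^ 2 \<le> S ^ 5" "S ^ 3 \<le> S ^ 5"
    using assms(1) power_increasing[of 1 5 S] power_increasing[of 2 5 S] power_increasing[of 3 5 S] by auto
  show ?thesis using 1 2 N p assms(2-5) by linarith
qed

theorem theorem12:
  shows "\<exists>(P::com) (c::nat) (k::nat).
    \<forall>(m::nat) (R::bits ring) (n::nat) (d::nat) (C::bits circuit).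
      string_ring m R \<longrightarrow> wf_circuit R n C \<longrightarrow> nc_degree R (circuit_poly R n C) \<le> d \<longrightarrow>
      (let f = circuit_poly R n C;
           T = c * (n + d + m + length C) ^ k;
           D = run m R T (start P (pit_input m R n d C))
       in (\<forall>cf \<in> set_pmf D. halted cf) \<and>
          (f = \<zero>\<^bsub>free_algebra R n\<^esub> \<longrightarrow> measure_pmf.prob D {cf. accepting cf} = 1) \<and>
          (f \<noteq> \<zero>\<^bsub>free_algebra R n\<^esub> \<longrightarrow> measure_pmf.prob D {cf. accepting cf} \<le> 1 / 3))"
proof (rule exI[of _ pit_program], rule exI[of _ "128000 * 300 ^ 3"], rule exI[of _ 15], intro allI impI)
  fix m :: nat and R :: "bits ring" and n d :: nat and C :: "bits circuit"
  assume R: "string_ring m R" and wf: "wf_circuit R n C" and deg: "nc_degree R (circuit_poly R n C) \<le> d"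
  interpret cring R using R by (simp add: string_ring_def)
  define S where "S = n + d + m + length C"
  have C: "C \<noteq> []" using wf by (simp add: wf_circuit_def)
  then have S: "1 \<le> S" unfolding S_def by (cases C) auto
  define l where "l = (LEAST l. 3 * d \<le> 2 ^ l)"
  have "3 * d \<le> 2 ^ (3 * d)" using less_exp[of "3 * d"] by simp
  then have l: "3 * d \<le> 2 ^ l" unfolding l_def by (rule LeastI)
  have l_least: "2 ^ j < 3 * d" if "j < l" for j
    using not_less_Least[of j "\<lambda>l. 3 * d \<le> 2 ^ l"] that by (simp add: l_def)
  define K :: nat where "K = 2 ^ l"
  have K: "0 < K" by (simp add: K_def)
  \<comment> \<open>By minimality of \<open>l\<close>, half of \<open>K\<close> is below
    \<open>3 * d\<close>; the summand 1 covers \<open>l = 0\<close>.\<close>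
  have "K \<le> 6 * d + 1"
  proof (cases l)
    case (Suc j)
    then show ?thesis using l_least[of j] by (simp add: K_def)
  qed (simp add: K_def)
  then have K7: "K \<le> 7 * S" using S by (simp add: S_def)
  define N where "N = (d + 1) * K"
  define B where "B = 300 * S ^ 5"
  \<comment> \<open>This is \<open>128000 * B ^ 3\<close> with \<open>B = 300 * S ^ 5\<close>, the
    source of the exponent 15.\<close>
  define T where "T = 128000 * 300 ^ 3 * S ^ 15"
  have TB: "T = 128000 * B ^ 3" by (simp add: T_def B_def power_mult_distrib flip: power_mult)
  define f where "f = circuit_poly R n C"
  have f_closed: "f \<in> carrier (free_algebra R n)"
    using C wf gate_polys_closed[of C n "length C - 1"]
    by (simp add: f_def circuit_poly_eq_nth wf_circuit_def)
  define start_cf where "start_cf = start pit_program (pit_input m R n d C)"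
  \<comment> \<open>The first summand keeps the run from getting stuck, the second makes the table
    complete; adding them avoids comparing them.\<close>
  define bits where "bits = replicate_pmf (T + N * n * l) (bernoulli_pmf (1/2))"
  define final where "final bs = fst (drun m R T (start_cf, bs))" for bs
  define row_zero where "row_zero L \<longleftrightarrow> (\<forall>q<N. ring_automaton.ev n d K L R f 0 q = \<zero>\<^bsub>R\<^esub>)" for L
  have run: "run m R T start_cf = map_pmf final bits"
    unfolding final_def bits_def by (rule run_eq_map_drun) simp
  \<comment> \<open>For every single list of coins, acceptance coincides with the vanishing of the
    row for the table spelt by that list. For the zero polynomial every list accepts, hence
    probability exactly 1.\<close>
  have fin: "halted (final bs) \<and> (accepting (final bs) \<longleftrightarrow> row_zero (chunks l (N * n) bs)) \<and>
     (f = \<zero>\<^bsub>free_algebra R n\<^esub> \<longrightarrow> row_zero (chunks l (N * n) bs))" if bs: "bs \<in> set_pmf bits" for bs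
  proof -
    let ?L = "chunks l (N * n) bs"
    interpret A: ring_automaton n d K ?L R
      by unfold_locales (use K in \<open>auto simp: N_def K_def intro!: chunks_less\<close>)
    have N: "A.N = N" by (simp add: A.N_def N_def)
    interpret P: pit_run m n d K B ?L R C l bs
    proof unfold_locales
      show "6 + 3 * length C + A.N * n + length C * A.N * A.N + A.N + n + K + 3 * d \<le> B"
        unfolding N B_def by (rule B_bound) (use S K7 in \<open>auto simp: S_def N_def\<close>)
      show "A.N * n * l \<le> length bs" using bs by (simp add: N bits_def set_replicate_pmf)
      show "?L = chunks l (A.N * n) bs" by (simp only: N)
    qed (use R wf l l_least in \<open>auto simp: K_def string_ring_def\<close>)
    obtain r h bs' where "drun m R T (start_cf, bs) = ((Skip, r, h), bs')" "r 0 = of_bool (row_zero ?L)"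
      using P.pit_program_drun[of T] TB N
      by (auto simp: start_cf_def row_zero_def f_def)
    moreover have "row_zero ?L" if "f = \<zero>\<^bsub>free_algebra R n\<^esub>"
      using that by (simp add: row_zero_def A.ev_def free_algebra_def)
    ultimately show ?thesis by (auto simp: final_def halted_def accepting_def)
  qed
  have halts: "\<forall>cf\<in>set_pmf (map_pmf final bits). halted cf" using fin by auto
  have one: "measure_pmf.prob (map_pmf final bits) {cf. accepting cf} = 1" if "f = \<zero>\<^bsub>free_algebra R n\<^esub>"
    using fin that by (subst measure_pmf.prob_eq_1) (auto simp: AE_measure_pmf_iff)
  have third: "measure_pmf.prob (map_pmf final bits) {cf. accepting cf} \<le> 1 / 3" if f0: "f \<noteq> \<zero>\<^bsub>free_algebra R n\<^esub>"
  proof -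
    have "measure_pmf.prob (map_pmf final bits) {cf. accepting cf} =
        measure_pmf.prob bits {bs. accepting (final bs)}"
      by (simp add: vimage_def)
    also have "\<dots> \<le> measure_pmf.prob bits {bs. row_zero (chunks l (N * n) bs)}"
      by (rule measure_pmf.finite_measure_mono_AE) (use fin in \<open>auto simp: AE_measure_pmf_iff\<close>)
    also have "\<dots> = measure_pmf.prob (map_pmf (chunks l (N * n)) bits) {L. row_zero L}"
      by (simp add: vimage_def)
    also have "map_pmf (chunks l (N * n)) bits = replicate_pmf (N * n) (pmf_of_set {..<K})"
      unfolding bits_def K_def by (rule map_chunks_replicate_pmf) simp
    also have "measure_pmf.prob \<dots> {L. row_zero L} \<le> d / K"
      using prob_row_zero_le[OF f_closed f0 _ K] deg by (simp add: row_zero_def N_def f_def)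
    also have "real (3 * d) \<le> real K" using l by (simp only: K_def of_nat_le_iff)
    then have "d / K \<le> 1 / (3 :: real)" using K by (simp add: field_simps)
    finally show ?thesis .
  qed
  show "let f = circuit_poly R n C; T = 128000 * 300 ^ 3 * (n + d + m + length C) ^ 15;
           D = run m R T (start pit_program (pit_input m R n d C))
       in (\<forall>cf \<in> set_pmf D. halted cf) \<and>
          (f = \<zero>\<^bsub>free_algebra R n\<^esub> \<longrightarrow> measure_pmf.prob D {cf. accepting cf} = 1) \<and>
          (f \<noteq> \<zero>\<^bsub>free_algebra R n\<^esub> \<longrightarrow> measure_pmf.prob D {cf. accepting cf} \<le> 1 / 3)"
    unfolding Let_def S_def[symmetric] T_def[symmetric] start_cf_def[symmetric] f_def[symmetric] run
    using halts one third by blast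
qed

end
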